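(* There exist absolute constants $C,c>0$ such that the following holds. Let $G:\mathbb{R}^k\to\mathbb{R}^n$ be a feedforward neural network of depth $d$ with only ReLU activations and at most $c_0\ge 2$ nodes in each layer. Let $\alpha\in(0,1)$, let $l\le n$ be a positive integer, $\epsilon_{\max}\ge0$ and $\delta\ge0$. Let $A\in\mathbb{R}^{m\times n}$ have i.i.d. entries $A_{ij}\sim\mathcal{N}(0,1/m)$ with $$m\ge\frac{C}{\alpha^2}\Big((k+l)\,d\log c_0+(k+l)\log(n/l)\Big).$$ Then with probability at least $1-e^{-c\alpha^2m}$ there exists a decoder $\Delta:\mathbb{R}^m\to\mathbb{R}^n$ such that for all $x\in\mathbb{R}^n$ and all $\epsilon\in\mathbb{R}^m$ with $\|\epsilon\|_2\le\epsilon_{\max}$, $$\|x-\Delta(Ax+\epsilon)\|_2\le(2l)^{-1/2}C_0\,\sigma_{l,G}(x)+C_1\epsilon_{\max}+\delta',$$ where $C_0=2\big((1+\alpha)(1-\alpha)^{-1}+1\big)$, $C_1=2(1-\alpha)^{-1}$, $\delta'=\delta(1-\alpha)^{-1}$.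
   Context: A depth-$d$ ReLU network is a map $G(z)=W_d\,\mathrm{ReLU}(W_{d-1}\cdots\mathrm{ReLU}(W_1z+b_1)\cdots+b_{d-1})+b_d$ with affine layers and coordinatewise $\mathrm{ReLU}(t)=\max(t,0)$; "at most $c_0$ nodes per layer" means each intermediate layer has dimension at most $c_0$. For $v\in\mathbb{R}^n$ and $s\ge0$, $S_s(v)=\{x\in\mathbb{R}^n:\|x-v\|_0\le s\}$, where $\|\cdot\|_0$ counts nonzero coordinates. $S_{s,G}=\bigcup_{z\in\mathbb{R}^k}S_s(G(z))$, and $\sigma_{l,G}(x)=\inf_{\hat x\in S_{l,G}}\|x-\hat x\|_1$. *)

theory Defs
  imports "HOL-Probability.Probability"
begin

text \<open>Vectors in R^n are represented as functions nat => real that vanish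
outside {..<n}; an m x n matrix is a function on nat x nat.\<close>

definition vec_in :: "nat \<Rightarrow> (nat \<Rightarrow> real) \<Rightarrow> bool" where
  "vec_in n x \<longleftrightarrow> (\<forall>i\<ge>n. x i = 0)"

definition norm2 :: "nat \<Rightarrow> (nat \<Rightarrow> real) \<Rightarrow> real" where
  "norm2 n x = sqrt (\<Sum>i<n. (x i)^2)"

definition norm1 :: "nat \<Rightarrow> (nat \<Rightarrow> real) \<Rightarrow> real" where
  "norm1 n x = (\<Sum>i<n. \<bar>x i\<bar>)"

definition norm0 :: "nat \<Rightarrow> (nat \<Rightarrow> real) \<Rightarrow> nat" where
  "norm0 n x = card {i. i < n \<and> x i \<noteq> 0}"

text \<open>Layer = (W, b, input dimension p, output dimension q).\<close>
type_synonym layer = "(nat \<Rightarrow> nat \<Rightarrow> real) \<times> (nat \<Rightarrow> real) \<times> nat \<times> nat"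

definition affine :: "layer \<Rightarrow> (nat \<Rightarrow> real) \<Rightarrow> (nat \<Rightarrow> real)" where
  "affine L v = (case L of (W, b, p, q) \<Rightarrow>
     (\<lambda>i. if i < q then (\<Sum>j<p. W i j * v j) + b i else 0))"

definition relu :: "(nat \<Rightarrow> real) \<Rightarrow> (nat \<Rightarrow> real)" where
  "relu v = (\<lambda>i. max (v i) 0)"

fun net_eval :: "layer list \<Rightarrow> (nat \<Rightarrow> real) \<Rightarrow> (nat \<Rightarrow> real)" where
  "net_eval [] v = v"
| "net_eval [L] v = affine L v"
| "net_eval (L # L' # Ls) v = net_eval (L' # Ls) (relu (affine L v))"

definition in_dim :: "layer \<Rightarrow> nat" where "in_dim L = fst (snd (snd L))"
definition out_dim :: "layer \<Rightarrow> nat" where "out_dim L = snd (snd (snd L))"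

definition relu_net :: "nat \<Rightarrow> nat \<Rightarrow> nat \<Rightarrow> nat \<Rightarrow> ((nat \<Rightarrow> real) \<Rightarrow> (nat \<Rightarrow> real)) \<Rightarrow> bool" where
  "relu_net k n d c0 G \<longleftrightarrow> (\<exists>Ls. length Ls = d \<and> d \<ge> 1 \<and>
      in_dim (hd Ls) = k \<and> out_dim (last Ls) = n \<and>
      (\<forall>i. i + 1 < d \<longrightarrow> out_dim (Ls ! i) = in_dim (Ls ! (i+1)) \<and> out_dim (Ls ! i) \<le> c0) \<and>
      G = net_eval Ls)"

definition S_s :: "nat \<Rightarrow> nat \<Rightarrow> (nat \<Rightarrow> real) \<Rightarrow> (nat \<Rightarrow> real) set" where
  "S_s n s v = {x. vec_in n x \<and> norm0 n (\<lambda>i. x i - v i) \<le> s}"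

definition S_G :: "nat \<Rightarrow> nat \<Rightarrow> nat \<Rightarrow> ((nat \<Rightarrow> real) \<Rightarrow> (nat \<Rightarrow> real)) \<Rightarrow> (nat \<Rightarrow> real) set" where
  "S_G k n s G = (\<Union>z\<in>{z. vec_in k z}. S_s n s (G z))"

definition sigma_G :: "nat \<Rightarrow> nat \<Rightarrow> nat \<Rightarrow> ((nat \<Rightarrow> real) \<Rightarrow> (nat \<Rightarrow> real)) \<Rightarrow> (nat \<Rightarrow> real) \<Rightarrow> real" where
  "sigma_G k n l G x = (INF xh\<in>S_G k n l G. norm1 n (\<lambda>i. x i - xh i))"

definition matvec :: "nat \<Rightarrow> nat \<Rightarrow> (nat \<times> nat \<Rightarrow> real) \<Rightarrow> (nat \<Rightarrow> real) \<Rightarrow> (nat \<Rightarrow> real)" where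
  "matvec m n A x = (\<lambda>i. if i < m then (\<Sum>j<n. A (i, j) * x j) else 0)"

definition gauss_mat :: "nat \<Rightarrow> nat \<Rightarrow> (nat \<times> nat \<Rightarrow> real) measure" where
  "gauss_mat m n = PiM ({..<m} \<times> {..<n}) (\<lambda>_. density lborel (normal_density 0 (1 / sqrt (real m))))"

end

theory Submission
  imports Defs
begin

text \<open>Each ReLU layer splits \<open>\<real>\<^sup>k\<close> into at most \<open>(c\<^sub>0 + 1)\<^sup>k\<close> cells, so the range of \<open>G\<close> lies in
at most \<open>(c\<^sub>0 + 1)\<^bsup>k (d - 1)\<^esup>\<close> affine images of \<open>\<real>\<^sup>k\<close>. Hence the vectors \<open>G z - G z' + w\<close> with
\<open>w\<close> being \<open>4 l\<close>-sparse lie in a controlled number of subspaces of dimension at most \<open>2 k + 1 + 4 l\<close>, and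
a Gaussian matrix is nearly isometric on all of them by a net argument with a chi-square tail bound.

For such a matrix, two signals with the same noisy measurement are close: peel the \<open>2 l\<close> largest
entries off the difference of the two approximation errors; what remains is a sum of \<open>2 l\<close>-sparse
blocks controlled by the \<open>\<ell>\<^sub>1\<close> errors, and the rest is of the form \<open>G z - G z' + w\<close>. The decoder
returns a limit of feasible signals whose \<open>\<sigma>\<close> tends to the infimum.\<close>

text \<open>The good event is near-isometry of \<open>A\<close> on one finite set of vectors fixed
  before \<open>A\<close> is drawn. Being given by finitely many conditions it is measurable,
  whereas the existence of a decoder quantifies over all functions; hence the conclusion exhibits an
  event contained in that set. Two signals with the same measurement may lie near different pieces
  of \<open>G\<close>, so near-isometry is required across every pair of pieces, at the cost of
  squaring their number. Letting each piece act on all of R^k, and not only on its cell, turns the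
  differences into subsets of linear spaces. The sparsity 4 l is l + l + 2 l: one l for each of the
  two approximants and 2 l for the peeled head. Passing from the net to its span multiplies the
  tolerance by 5, so the net is tested at \<alpha> / 5 and the tail exponent is m \<alpha>^2 / 400.
  Half of it pays for the net, whose logarithmic size is at most 100 times the bracket in the
  hypothesis on m; this leaves c = 1/800 and forces C = 100 * 800.\<close>

section \<open>Affine pieces of ReLU networks\<close>

text \<open>If both values of the last sign occur for a given pattern of the others, convexity gives a
  point with that pattern on the last hyperplane, where one coordinate can be eliminated.\<close>
lemma card_sign_patterns:
  fixes a :: "nat \<Rightarrow> 'b \<Rightarrow> real" and c :: "nat \<Rightarrow> real"
  assumes "finite J"
  shows "card (range (\<lambda>t. {i. i < N \<and> c i + (\<Sum>j\<in>J. a i j * t j) > 0})) \<le> (N + 1) ^ card J"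
  using assms
proof (induction N arbitrary: J a c)
  case 0
  then show ?case by simp
next
  case (Suc N)
  define f where "f = (\<lambda>i t. c i + (\<Sum>j\<in>J. a i j * t j))"
  define P where "P = (\<lambda>t. {i. i < Suc N \<and> f i t > 0})"
  define Q where "Q = (\<lambda>t. {i. i < N \<and> f i t > 0})"
  define R0 where "R0 = Q ` {t. f N t \<le> 0}"
  define R1 where "R1 = Q ` {t. f N t > 0}"
  have finQ: "finite (Q ` X)" for X
    by (rule finite_subset[of _ "Pow {..<N}"]) (auto simp: Q_def)
  have "range P = P ` {t. f N t \<le> 0} \<union> P ` {t. f N t > 0}"
    by (subst image_Un[symmetric]) (rule arg_cong[of _ _ "image P"], auto)
  also have "P ` {t. f N t \<le> 0} = R0"
    unfolding R0_def by (rule image_cong) (auto simp: P_def Q_def less_Suc_eq)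
  also have "P ` {t. f N t > 0} = insert N ` R1"
    unfolding R1_def image_image by (rule image_cong) (auto simp: P_def Q_def less_Suc_eq)
  finally have "card (range P) \<le> card R0 + card (insert N ` R1)"
    by (simp add: card_Un_le)
  also have "card (insert N ` R1) \<le> card R1"
    by (rule card_image_le) (simp add: R1_def finQ)
  \<comment> \<open>Deletion and restriction: the union consists of the patterns of the first
    \<open>N\<close> functions, the intersection of those that occur on both sides of the last
    hyperplane.\<close>
  also have "card R0 + card R1 = card (R0 \<union> R1) + card (R0 \<inter> R1)"
    by (rule card_Un_Int) (auto simp: R0_def R1_def finQ)
  also have "card (R0 \<union> R1) \<le> card (range Q)"
    by (rule card_mono) (auto simp: R0_def R1_def finQ)
  also have "card (range Q) \<le> (N + 1) ^ card J"
    using Suc.IH[OF Suc.prems, of c a] by (simp add: Q_def f_def)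
  finally have le: "card (range P) \<le> (N + 1) ^ card J + card (R0 \<inter> R1)" by simp
  have "(N + 1) ^ card J + card (R0 \<inter> R1) \<le> (Suc N + 1) ^ card J"
  proof (cases "\<exists>j\<in>J. a N j \<noteq> 0")
    case False
    then have "f N t = c N" for t by (simp add: f_def)
    then have "R0 = {} \<or> R1 = {}" by (auto simp: R0_def R1_def)
    then have "card (R0 \<inter> R1) = 0" by auto
    then show ?thesis using power_mono[of "N+1" "Suc N + 1" "card J"] by simp
  next
    case True
    then obtain j0 where j0: "j0 \<in> J" "a N j0 \<noteq> 0" by blast
    define J' where "J' = J - {j0}"
    define a' where "a' = (\<lambda>i j. a i j - a i j0 * a N j / a N j0)"
    define c' where "c' = (\<lambda>i. c i - a i j0 * c N / a N j0)"
    have J: "J = insert j0 J'" "j0 \<notin> J'" "finite J'" using j0 Suc.prems by (auto simp: J'_def)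
    have f': "f i t = c' i + (\<Sum>j\<in>J'. a' i j * t j)" if "f N t = 0" for i t
    proof -
      have t: "t j0 = - (c N + (\<Sum>j\<in>J'. a N j * t j)) / a N j0"
        using that j0(2) J by (simp add: f_def field_simps)
      have "f i t = c i + a i j0 * t j0 + (\<Sum>j\<in>J'. a i j * t j)"
        using J by (simp add: f_def)
      also have "\<dots> = c' i + ((\<Sum>j\<in>J'. a i j * t j) - a i j0 / a N j0 * (\<Sum>j\<in>J'. a N j * t j))"
        unfolding t c'_def using j0(2) by (simp add: field_simps)
      also have "\<dots> = c' i + (\<Sum>j\<in>J'. a' i j * t j)"
        unfolding sum_distrib_left sum_subtractf[symmetric] a'_def
        by (intro arg_cong2[of _ _ _ _ "(+)"] refl sum.cong) (simp add: left_diff_distrib)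
      finally show ?thesis .
    qed
    have "R0 \<inter> R1 \<subseteq> range (\<lambda>t. {i. i < N \<and> c' i + (\<Sum>j\<in>J'. a' i j * t j) > 0})"
    proof
      fix p assume "p \<in> R0 \<inter> R1"
      then obtain t t' where t: "p = Q t" "f N t \<le> 0" and t': "p = Q t'" "f N t' > 0"
        by (auto simp: R0_def R1_def)
      \<comment> \<open>The weight at which the segment from \<open>t'\<close> to \<open>t\<close>
        meets the zero set of the last function.\<close>
      define u where "u = f N t' / (f N t' - f N t)"
      have u: "0 \<le> u" "u \<le> 1" using t(2) t'(2) by (auto simp: u_def field_simps)
      \<comment> \<open>Patterns record strict positivity, so \<open>t\<close> must carry positive
        weight; the weight of \<open>t'\<close> vanishes when \<open>f N t = 0\<close>.\<close>
      have "u > 0" using t(2) t'(2) by (simp add: u_def)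
      define w where "w = (\<lambda>j. u * t j + (1 - u) * t' j)"
      have fw: "f i w = u * f i t + (1 - u) * f i t'" for i
      proof -
        have "(\<Sum>j\<in>J. a i j * w j) = u * (\<Sum>j\<in>J. a i j * t j) + (1 - u) * (\<Sum>j\<in>J. a i j * t' j)"
          unfolding sum_distrib_left sum.distrib[symmetric] w_def
          by (intro sum.cong refl) (simp add: algebra_simps)
        then show ?thesis by (simp add: f_def algebra_simps)
      qed
      have "u * (f N t' - f N t) = f N t'" using t(2) t'(2) by (simp add: u_def)
      then have "f N w = 0" unfolding fw by (simp add: algebra_simps)
      moreover have "f i w > 0 \<longleftrightarrow> i \<in> p" if "i < N" for i
      proof -
        have ip: "i \<in> p \<longleftrightarrow> f i t > 0" using that t(1) by (simp add: Q_def)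
        have ip': "i \<in> p \<longleftrightarrow> f i t' > 0" using that t'(1) by (simp add: Q_def)
        show ?thesis
        proof (cases "i \<in> p")
        case True
        then have "f i t > 0" "f i t' > 0" using ip ip' by auto
        then have "u * f i t > 0" "(1 - u) * f i t' \<ge> 0" using u \<open>u > 0\<close> by auto
        then show ?thesis using True by (simp add: fw)
      next
        case False
        then have "f i t \<le> 0" "f i t' \<le> 0" using ip ip' by auto
        then have "u * f i t \<le> 0" "(1 - u) * f i t' \<le> 0" using u
          by (auto simp: mult_le_0_iff)
        then show ?thesis using False by (simp add: fw)
      qed
    qed
      moreover have "p \<subseteq> {..<N}" using t by (auto simp: Q_def)
      ultimately have "p = {i. i < N \<and> c' i + (\<Sum>j\<in>J'. a' i j * w j) > 0}"
        using f'[of w] by auto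
      then show "p \<in> range (\<lambda>t. {i. i < N \<and> c' i + (\<Sum>j\<in>J'. a' i j * t j) > 0})" by blast
    qed
    then have "card (R0 \<inter> R1) \<le> card (range (\<lambda>t. {i. i < N \<and> c' i + (\<Sum>j\<in>J'. a' i j * t j) > 0}))"
      by (intro card_mono) (auto intro!: finite_subset[of _ "Pow {..<N}"])
    also have "\<dots> \<le> (N + 1) ^ card J'" by (rule Suc.IH[OF J(3)])
    finally have 1: "card (R0 \<inter> R1) \<le> (N + 1) ^ card J'" .
    have "card J = Suc (card J')" using J by simp
    \<comment> \<open>With \<open>card J = card J' + 1\<close> the left side is exactly
      \<open>(N + 1) ^ card J + (N + 1) ^ card J'\<close>.\<close>
    moreover have "(N + 1) ^ card J' * (N + 2) \<le> (N + 2) ^ card J' * (N + 2)"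
      by (intro mult_right_mono power_mono) auto
    ultimately show ?thesis using 1 by (simp add: algebra_simps)
  qed
  with le show ?case by (simp add: P_def f_def)
qed

definition affine_map :: "nat \<Rightarrow> (nat \<Rightarrow> nat \<Rightarrow> real) \<times> (nat \<Rightarrow> real) \<Rightarrow> (nat \<Rightarrow> real) \<Rightarrow> nat \<Rightarrow> real" where
  "affine_map k p z = (\<lambda>i. snd p i + (\<Sum>j<k. fst p i j * z j))"

lemma affine_affine_map:
  "\<exists>r. \<forall>z. affine L (affine_map k p z) = affine_map k r z"
proof -
  obtain W b p0 q where L: "L = (W, b, p0, q)" by (cases L)
  define r where "r = ((\<lambda>i j. if i < q then (\<Sum>h<p0. W i h * fst p h j) else 0),
                       (\<lambda>i. if i < q then (\<Sum>h<p0. W i h * snd p h) + b i else 0))"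
  have "affine L (affine_map k p z) i = affine_map k r z i" for z i
  proof (cases "i < q")
    case True
    have "(\<Sum>h<p0. W i h * (\<Sum>j<k. fst p h j * z j)) = (\<Sum>j<k. (\<Sum>h<p0. W i h * fst p h j) * z j)"
      by (simp add: sum_distrib_left sum_distrib_right mult.assoc) (rule sum.swap)
    then show ?thesis using True
      by (simp add: affine_def L affine_map_def r_def algebra_simps sum.distrib)
  next
    case False
    then show ?thesis by (simp add: affine_def L affine_map_def r_def)
  qed
  then show ?thesis by (intro exI[of _ r]) auto
qed

lemma affine_eq_0: "out_dim L \<le> i \<Longrightarrow> affine L v i = 0"
  by (cases L) (auto simp: affine_def out_dim_def)

text \<open>Where the set of positive preactivations is constant, ReLU zeroes the remaining rows,
  which is again an affine map. The exponent is the number \<open>k\<close> of input variables,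
  since the sign patterns are counted in the domain of the composed map and not in the
  layer.\<close>

lemma relu_affine_pieces:
  "\<exists>P. finite P \<and> card P \<le> (out_dim L + 1) ^ k \<and>
       (\<forall>z. \<exists>p\<in>P. relu (affine L (affine_map k h z)) = affine_map k p z)"
proof -
  obtain r where r: "\<And>z. affine L (affine_map k h z) = affine_map k r z"
    using affine_affine_map[of L k h] by blast
  define pat where "pat = (\<lambda>z. {i. i < out_dim L \<and> snd r i + (\<Sum>j<k. fst r i j * z j) > 0})"
  define keep where "keep = (\<lambda>T::nat set. ((\<lambda>i j. if i \<in> T then fst r i j else 0),
                                     (\<lambda>i. if i \<in> T then snd r i else 0)))"
  have "card (range pat) \<le> (out_dim L + 1) ^ card {..<k}"
    unfolding pat_def by (rule card_sign_patterns) simp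
  moreover have fin: "finite (range pat)"
    by (rule finite_subset[of _ "Pow {..<out_dim L}"]) (auto simp: pat_def)
  ultimately have "card (keep ` range pat) \<le> (out_dim L + 1) ^ k"
    using card_image_le[OF fin, of keep] by simp
  moreover have "relu (affine L (affine_map k h z)) = affine_map k (keep (pat z)) z" for z
  proof
    fix i
    \<comment> \<open>Coordinates past the output dimension belong to no pattern, so
      \<open>keep\<close> zeroes them; the layer does the same.\<close>
    have "affine_map k r z i = 0" if "\<not> i < out_dim L"
      using r[of z] affine_eq_0[of L i "affine_map k h z"] that by simp
    moreover have "relu (affine L (affine_map k h z)) i = max (affine_map k r z i) 0"
      by (simp add: r relu_def)
    ultimately show "relu (affine L (affine_map k h z)) i = affine_map k (keep (pat z)) z i"
      by (auto simp: affine_map_def keep_def pat_def)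
  qed
  ultimately show ?thesis using fin by (intro exI[of _ "keep ` range pat"]) auto
qed

text \<open>The affine map \<open>h\<close> is general because, once the first layer is replaced by
  one of its pieces, the rest of the network is again applied to an affine function of the same
  \<open>k\<close> variables. Hence every layer contributes the same factor, except the last, which
  has no ReLU.\<close>

lemma net_eval_pieces:
  assumes "Ls \<noteq> []" and "\<And>i. i + 1 < length Ls \<Longrightarrow> out_dim (Ls ! i) \<le> c0"
  shows "\<exists>P. finite P \<and> card P \<le> ((c0 + 1) ^ k) ^ (length Ls - 1) \<and>
       (\<forall>z. \<exists>p\<in>P. net_eval Ls (affine_map k h z) = affine_map k p z)"
  using assms
proof (induction Ls arbitrary: h)
  case Nil
  then show ?case by simp
next
  case (Cons L Ls)
  show ?case
  proof (cases Ls)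
    case Nil
    obtain r where "\<And>z. affine L (affine_map k h z) = affine_map k r z"
      using affine_affine_map[of L k h] by blast
    then show ?thesis using Nil by (intro exI[of _ "{r}"]) auto
  next
    case (Cons L' Ls')
    define K where "K = (c0 + 1) ^ k"
    have IH: "\<exists>P. finite P \<and> card P \<le> K ^ (length Ls - 1) \<and>
       (\<forall>z. \<exists>p\<in>P. net_eval Ls (affine_map k h z) = affine_map k p z)" for h
      unfolding K_def
    proof (rule Cons.IH)
      show "Ls \<noteq> []" using Cons by simp
      show "out_dim (Ls ! i) \<le> c0" if "i + 1 < length Ls" for i
        using Cons.prems(2)[of "Suc i"] that by simp
    qed
    then obtain PP where PP: "\<And>h. finite (PP h)" "\<And>h. card (PP h) \<le> K ^ (length Ls - 1)"
       "\<And>h z. \<exists>p\<in>PP h. net_eval Ls (affine_map k h z) = affine_map k p z" by metis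
    obtain P0 where P0: "finite P0" "card P0 \<le> (out_dim L + 1) ^ k"
       "\<And>z. \<exists>p\<in>P0. relu (affine L (affine_map k h z)) = affine_map k p z"
      using relu_affine_pieces by blast
    have "out_dim L \<le> c0" using Cons.prems(2)[of 0] Cons by simp
    then have "(out_dim L + 1) ^ k \<le> K" unfolding K_def by (intro power_mono) auto
    with P0(2) have cP0: "card P0 \<le> K" by linarith
    define P where "P = (\<Union>h\<in>P0. PP h)"
    have "card P \<le> (\<Sum>h\<in>P0. card (PP h))" unfolding P_def by (rule card_UN_le[OF P0(1)])
    also have "\<dots> \<le> (\<Sum>h\<in>P0. K ^ (length Ls - 1))" by (intro sum_mono PP)
    also have "\<dots> = card P0 * K ^ (length Ls - 1)" by simp
    also have "\<dots> \<le> K * K ^ (length Ls - 1)" using cP0 by (intro mult_right_mono) auto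
    also have "\<dots> = K ^ (length (L # Ls) - 1)" using Cons by simp
    finally have "card P \<le> K ^ (length (L # Ls) - 1)" .
    moreover have "\<exists>p\<in>P. net_eval (L # Ls) (affine_map k h z) = affine_map k p z" for z
    proof -
      obtain h' where h': "h' \<in> P0" "relu (affine L (affine_map k h z)) = affine_map k h' z"
        using P0(3) by blast
      obtain p where "p \<in> PP h'" "net_eval Ls (affine_map k h' z) = affine_map k p z"
        using PP(3) by blast
      then show ?thesis using h' Cons by (intro bexI[of _ p]) (auto simp: P_def)
    qed
    ultimately show ?thesis using P0(1) PP(1) unfolding K_def P_def by blast
  qed
qed

lemma relu_net_pieces:
  assumes "relu_net k n d c0 G"
  shows "\<exists>P. finite P \<and> card P \<le> (c0 + 1) ^ (k * (d - 1)) \<and>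
       (\<forall>z. vec_in k z \<longrightarrow> (\<exists>p\<in>P. G z = affine_map k p z))"
proof -
  obtain Ls where Ls: "length Ls = d" "d \<ge> 1"
    "\<And>i. i + 1 < d \<Longrightarrow> out_dim (Ls ! i) \<le> c0" "G = net_eval Ls"
    using assms by (auto simp: relu_net_def)
  \<comment> \<open>The identity starts the induction over layers; it reproduces \<open>z\<close>
    only when \<open>z\<close> vanishes from index \<open>k\<close> on.\<close>
  define I where "I = ((\<lambda>i j. if i = j then 1 else 0) :: nat \<Rightarrow> nat \<Rightarrow> real, (\<lambda>_. 0) :: nat \<Rightarrow> real)"
  have I: "affine_map k I z = z" if "vec_in k z" for z
  proof
    fix i
    have "(\<Sum>j<k. (if i = j then 1 else 0) * z j) = (\<Sum>j<k. if i = j then z j else 0)"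
      by (intro sum.cong) auto
    then show "affine_map k I z i = z i"
      using that by (auto simp: affine_map_def I_def vec_in_def)
  qed
  have "Ls \<noteq> []" using Ls(1,2) by auto
  then obtain P where "finite P" "card P \<le> ((c0 + 1) ^ k) ^ (length Ls - 1)"
       "\<And>z. \<exists>p\<in>P. net_eval Ls (affine_map k I z) = affine_map k p z"
    using net_eval_pieces[of Ls c0 k I] Ls by auto
  then show ?thesis using I Ls by (metis power_mult)
qed

section \<open>Near-isometry on a subspace from a net\<close>

definition dot :: "nat \<Rightarrow> (nat \<Rightarrow> real) \<Rightarrow> (nat \<Rightarrow> real) \<Rightarrow> real" where
  "dot n x y = (\<Sum>i<n. x i * y i)"

definition lincomb :: "nat \<Rightarrow> (nat \<Rightarrow> nat \<Rightarrow> real) \<Rightarrow> (nat \<Rightarrow> real) \<Rightarrow> nat \<Rightarrow> real" where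
  "lincomb D v c = (\<lambda>i. \<Sum>j<D. c j * v j i)"

definition orthonormal :: "nat \<Rightarrow> nat \<Rightarrow> (nat \<Rightarrow> nat \<Rightarrow> real) \<Rightarrow> bool" where
  "orthonormal n D e \<longleftrightarrow> (\<forall>i<D. \<forall>j<D. dot n (e i) (e j) = (if i = j then 1 else 0))"

lemma dot_commute: "dot n x y = dot n y x"
  by (simp add: dot_def mult.commute)

lemma dot_lincomb: "dot n (lincomb D v c) y = (\<Sum>j<D. c j * dot n (v j) y)"
  by (simp add: dot_def lincomb_def sum_distrib_left sum_distrib_right mult.assoc) (rule sum.swap)

lemma dot_lincomb_orthonormal:
  assumes "orthonormal n D e" "j < D"
  shows "dot n (lincomb D e c) (e j) = c j"
proof -
  have "(\<Sum>i<D. c i * dot n (e i) (e j)) = (\<Sum>i<D. if i = j then c i else 0)"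
    using assms by (intro sum.cong) (auto simp: orthonormal_def)
  then show ?thesis using assms by (simp add: dot_lincomb)
qed

lemma norm2_sq: "(norm2 n x)\<^sup>2 = dot n x x"
  by (simp add: norm2_def dot_def power2_eq_square sum_nonneg)

lemma dot_self_lincomb_orthonormal:
  assumes "orthonormal n D e"
  shows "dot n (lincomb D e c) (lincomb D e c) = (\<Sum>j<D. (c j)\<^sup>2)"
proof -
  have "dot n (lincomb D e c) (lincomb D e c) = (\<Sum>j<D. c j * dot n (lincomb D e c) (e j))"
    unfolding dot_lincomb[of n D e c "lincomb D e c"] by (simp add: dot_commute)
  also have "\<dots> = (\<Sum>j<D. (c j)\<^sup>2)"
    using dot_lincomb_orthonormal[OF assms] by (intro sum.cong) (auto simp: power2_eq_square)
  finally show ?thesis .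
qed

text \<open>The vectors \<open>v j\<close> may be dependent, so a vanishing residual is dropped and
  \<open>D'\<close> can be smaller than \<open>D\<close>. Agreement is claimed only below
  \<open>n\<close>, which is all that \<open>dot n\<close> sees.\<close>

lemma gram_schmidt:
  "\<exists>D' e. D' \<le> D \<and> orthonormal n D' e \<and>
     (\<forall>c. \<exists>c'. \<forall>i<n. lincomb D v c i = lincomb D' e c' i)"
proof (induction D)
  case 0
  show ?case by (intro exI[of _ 0]) (auto simp: orthonormal_def lincomb_def)
next
  case (Suc D)
  then obtain D' e where D': "D' \<le> D" and e: "orthonormal n D' e"
    and span: "\<And>c. \<exists>c'. \<forall>i<n. lincomb D v c i = lincomb D' e c' i" by blast
  define p where "p = (\<lambda>j. dot n (v D) (e j))"
  define w where "w = (\<lambda>i. v D i - lincomb D' e p i)"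
  have we: "dot n w (e j) = 0" if "j < D'" for j
  proof -
    have "dot n w (e j) = dot n (v D) (e j) - dot n (lincomb D' e p) (e j)"
      by (simp add: dot_def w_def left_diff_distrib sum_subtractf)
    then show ?thesis using dot_lincomb_orthonormal[OF e that] by (simp add: p_def)
  qed
  show ?case
  proof (cases "dot n w w = 0")
    case True
    have "w i = 0" if "i < n" for i
      using True that unfolding dot_def by (subst (asm) sum_nonneg_eq_0_iff) auto
    then have vD: "v D i = lincomb D' e p i" if "i < n" for i using that by (simp add: w_def)
    have "\<exists>c'. \<forall>i<n. lincomb (Suc D) v c i = lincomb D' e c' i" for c
    proof -
      obtain c' where c': "\<forall>i<n. lincomb D v c i = lincomb D' e c' i" using span by blast
      have "lincomb (Suc D) v c i = lincomb D' e (\<lambda>j. c' j + c D * p j) i" if "i < n" for i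
      proof -
        have "lincomb (Suc D) v c i = lincomb D v c i + c D * v D i" by (simp add: lincomb_def)
        also have "\<dots> = lincomb D' e c' i + c D * lincomb D' e p i" using c' vD that by simp
        finally show ?thesis
          by (simp add: lincomb_def sum_distrib_left algebra_simps sum.distrib)
      qed
      then show ?thesis by blast
    qed
    then show ?thesis using D' e by (intro exI[of _ D'] exI[of _ e]) auto
  next
    case False
    have "dot n w w \<ge> 0" unfolding dot_def by (intro sum_nonneg) auto
    with False have ww: "dot n w w > 0" by simp
    define q where "q = sqrt (dot n w w)"
    have q: "q > 0" "q * q = dot n w w" using ww by (auto simp: q_def)
    define f where "f = e(D' := (\<lambda>i. w i / q))"
    have fD: "dot n (f D') (f D') = 1"
    proof -
      have "dot n (f D') (f D') = dot n w w / (q * q)"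
        by (simp add: f_def dot_def times_divide_times_eq flip: sum_divide_distrib)
      then show ?thesis using q(2) ww by simp
    qed
    have fe: "dot n (f D') (f j) = 0" if "j < D'" for j
      using we[OF that] that by (simp add: f_def dot_def flip: sum_divide_distrib)
    have "orthonormal n (Suc D') f" unfolding orthonormal_def
    proof (intro allI impI)
      fix i j assume ij: "i < Suc D'" "j < Suc D'"
      consider "i < D'" "j < D'" | "i = D'" "j < D'" | "i < D'" "j = D'" | "i = D'" "j = D'"
        using ij by linarith
      then show "dot n (f i) (f j) = (if i = j then 1 else 0)"
      proof cases
        case 1 then show ?thesis using e by (simp add: f_def orthonormal_def)
      next
        case 2 then show ?thesis using fe by simp
      next
        case 3 then show ?thesis using fe[of i] by (simp add: dot_commute)
      next
        case 4 then show ?thesis using fD by simp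
      qed
    qed
    moreover have "\<exists>c'. \<forall>i<n. lincomb (Suc D) v c i = lincomb (Suc D') f c' i" for c
    proof -
      obtain c' where c': "\<forall>i<n. lincomb D v c i = lincomb D' e c' i" using span by blast
      have "lincomb (Suc D) v c i
            = lincomb (Suc D') f ((\<lambda>j. c' j + c D * p j)(D' := c D * q)) i" if "i < n" for i
      proof -
        have "lincomb (Suc D) v c i = lincomb D v c i + c D * v D i" by (simp add: lincomb_def)
        also have "\<dots> = lincomb D' e c' i + c D * lincomb D' e p i + c D * w i"
          using c' that by (simp add: w_def algebra_simps)
        also have "\<dots> = lincomb D' e (\<lambda>j. c' j + c D * p j) i + c D * w i"
          by (simp add: lincomb_def sum_distrib_left algebra_simps sum.distrib)
        finally show ?thesis using q by (simp add: lincomb_def f_def)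
      qed
      then show ?thesis by blast
    qed
    ultimately show ?thesis using D' by (intro exI[of _ "Suc D'"] exI[of _ f]) auto
  qed
qed

text \<open>Lattice points, scaled later by 1 / sqrt D. A rounded unit vector has sum of squares at
  most 4 D, and integers satisfy \<bar>a\<bar> \<le> a^2, whence the radius in the l1 norm. The l1
  form allows counting by a product of one-dimensional weights.\<close>

definition int_net :: "nat \<Rightarrow> (nat \<Rightarrow> int) set" where
  "int_net D = {a \<in> PiE {..<D} (\<lambda>_. {- int (4 * D)..int (4 * D)}). (\<Sum>i<D. \<bar>a i\<bar>) \<le> int (4 * D)}"

lemma finite_int_net: "finite (int_net D)"
  unfolding int_net_def by (rule finite_subset[OF Collect_restrict]) (simp add: finite_PiE)

lemma sum_half_power_abs_le:
  "(\<Sum>a\<in>{- int K..int K}. (1/2::real) ^ nat \<bar>a\<bar>) \<le> 3"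
proof -
  \<comment> \<open>The exact value is proved because the bound 3 alone does not pass through the
    induction.\<close>
  have "(\<Sum>a\<in>{- int K..int K}. (1/2::real) ^ nat \<bar>a\<bar>) = 3 - 2 * (1/2) ^ K"
  proof (induction K)
    case 0
    show ?case by simp
  next
    case (Suc K)
    let ?g = "\<lambda>a. (1/2::real) ^ nat \<bar>a\<bar>"
    have "{- int (Suc K)..int (Suc K)} = insert (- int (Suc K)) (insert (int (Suc K)) {- int K..int K})"
      by (rule set_eqI) (simp, presburger)
    then have "sum ?g {- int (Suc K)..int (Suc K)}
        = sum ?g (insert (- int (Suc K)) (insert (int (Suc K)) {- int K..int K}))" by (rule arg_cong)
    also have "\<dots> = ?g (- int (Suc K)) + (?g (int (Suc K)) + sum ?g {- int K..int K})"
      by (subst sum.insert; simp)+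
    also have "\<dots> = 3 - 2 * (1/2) ^ Suc K"
      unfolding Suc.IH by (simp add: nat_add_distrib)
    finally show ?case .
  qed
  then show ?thesis by simp
qed

text \<open>Each lattice point of the net has weight at least 1 under \<open>a \<mapsto> 2 ^ (4 D - \<Sum>\<bar>a i\<bar>)\<close>,
  and the total weight factorises over the coordinates.\<close>
lemma card_int_net: "real (card (int_net D)) \<le> 48 ^ D"
proof -
  define B where "B = {- int (4 * D)..int (4 * D)}"
  define wt where "wt = (\<lambda>a::nat \<Rightarrow> int. \<Prod>i<D. (1/2::real) ^ nat \<bar>a i\<bar>)"
  have "real (card (int_net D)) = (\<Sum>a\<in>int_net D. 1)" by simp
  also have "\<dots> \<le> (\<Sum>a\<in>int_net D. 2 ^ (4 * D) * wt a)"
  proof (rule sum_mono)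
    fix a assume "a \<in> int_net D"
    then have "(\<Sum>i<D. \<bar>a i\<bar>) \<le> int (4 * D)" by (simp add: int_net_def)
    moreover have "int (\<Sum>i<D. nat \<bar>a i\<bar>) = (\<Sum>i<D. \<bar>a i\<bar>)" by simp
    ultimately have le: "(\<Sum>i<D. nat \<bar>a i\<bar>) \<le> 4 * D" by linarith
    have "wt a = (1/2) ^ (\<Sum>i<D. nat \<bar>a i\<bar>)" by (simp add: wt_def power_sum)
    also have "\<dots> \<ge> (1/2) ^ (4 * D)" using le by (intro power_decreasing) auto
    finally have "2 ^ (4 * D) * (1/2) ^ (4 * D) \<le> 2 ^ (4 * D) * wt a" by (intro mult_left_mono) auto
    then show "1 \<le> 2 ^ (4 * D) * wt a" by (simp flip: power_mult_distrib)
  qed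
  also have "\<dots> \<le> (\<Sum>a\<in>PiE {..<D} (\<lambda>_. B). 2 ^ (4 * D) * wt a)"
  proof (rule sum_mono2)
    show "finite (PiE {..<D} (\<lambda>_. B))" by (rule finite_PiE) (simp_all add: B_def)
    show "int_net D \<subseteq> PiE {..<D} (\<lambda>_. B)" unfolding int_net_def B_def by (rule Collect_restrict)
    show "0 \<le> 2 ^ (4 * D) * wt a" for a unfolding wt_def by (intro mult_nonneg_nonneg prod_nonneg) auto
  qed
  also have "\<dots> = 2 ^ (4 * D) * (\<Prod>i<D. \<Sum>x\<in>B. (1/2) ^ nat \<bar>x\<bar>)"
    unfolding wt_def sum_distrib_left[symmetric] by (subst prod_sum_PiE) (simp_all add: B_def)
  also have "\<dots> \<le> 2 ^ (4 * D) * (\<Prod>i<D. 3)"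
    unfolding B_def using sum_half_power_abs_le[of "4 * D"]
    by (intro mult_left_mono prod_mono conjI sum_nonneg) auto
  \<comment> \<open>Each coordinate contributes 2^4 from the radius and 3 from the geometric
    series.\<close>
  also have "\<dots> = 48 ^ D" by (simp add: power_mult flip: power_mult_distrib)
  finally show ?thesis .
qed

text \<open>A quadratic differs from its chord over an interval of length \<open>h\<close> by
  \<bar>b\<bar> u (1 - u) h^2, with u the relative position, hence by at most \<bar>b\<bar> h^2 / 4;
  the chord never exceeds its larger endpoint value.\<close>

lemma quadratic_le_endpoint:
  fixes f :: "real \<Rightarrow> real"
  assumes f: "\<And>t. f t = b * t\<^sup>2 + g * t + r" and x: "x \<le> t" "t \<le> x + h" and "h > 0"
  shows "\<exists>s\<in>{x, x + h}. f t \<le> f s + \<bar>b\<bar> * h\<^sup>2 / 4"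
proof (rule ccontr)
  assume "\<not> ?thesis"
  then have n: "f x + \<bar>b\<bar> * h\<^sup>2 / 4 < f t" "f (x + h) + \<bar>b\<bar> * h\<^sup>2 / 4 < f t" by auto
  define u where "u = (t - x) / h"
  have u: "0 \<le> u" "u \<le> 1" "t = x + u * h" using x \<open>h > 0\<close> by (auto simp: u_def field_simps)
  define e where "e = f t - \<bar>b\<bar> * h\<^sup>2 / 4"
  have n': "f x < e" "f (x + h) < e" using n by (auto simp: e_def)
  have eq: "f t = (1 - u) * f x + u * f (x + h) - b * (u * (1 - u)) * h\<^sup>2"
    unfolding f u(3) by algebra
  have "u * (1 - u) \<le> 1/4" using zero_le_power2[of "u - 1/2"]
    by (simp add: power2_eq_square algebra_simps)
  moreover have u1: "0 \<le> u * (1 - u)" using u by simp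
  ultimately have "\<bar>b\<bar> * (u * (1 - u)) * h\<^sup>2 \<le> \<bar>b\<bar> * (1/4) * h\<^sup>2"
    by (intro mult_right_mono mult_left_mono) auto
  moreover have "- b * (u * (1 - u)) * h\<^sup>2 \<le> \<bar>b\<bar> * (u * (1 - u)) * h\<^sup>2"
    using u1 by (intro mult_right_mono) auto
  moreover have "(1 - u) * f x + u * f (x + h) < e"
    using n' u by (intro convex_bound_lt) auto
  ultimately show False using eq by (simp add: e_def)
qed

text \<open>The leading coefficient \<open>b i\<close> does not depend on the other coordinates, so
  rounding one coordinate leaves the loss at the next one unchanged and the losses simply add
  up.\<close>

lemma coordinatewise_quadratic_round:
  fixes F :: "(nat \<Rightarrow> real) \<Rightarrow> real" and h :: real
  assumes F: "\<And>c i. i < D \<Longrightarrow> \<exists>g r. \<forall>t. F (c(i := t)) = b i * t\<^sup>2 + g * t + r"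
    and h: "h > 0" and "K \<le> D"
  shows "\<exists>g. (\<forall>i\<ge>K. g i = c i) \<and> (\<forall>i<K. g i \<in> {h * real_of_int \<lfloor>c i / h\<rfloor>, h * real_of_int \<lfloor>c i / h\<rfloor> + h}) \<and>
             F c \<le> F g + (\<Sum>i<K. \<bar>b i\<bar> * h\<^sup>2 / 4)"
  using \<open>K \<le> D\<close>
proof (induction K)
  case 0
  show ?case by (rule exI[of _ c]) simp
next
  case (Suc K)
  then have K: "K < D" by simp
  then obtain g where g: "\<forall>i\<ge>K. g i = c i" "\<forall>i<K. g i \<in> {h * real_of_int \<lfloor>c i / h\<rfloor>, h * real_of_int \<lfloor>c i / h\<rfloor> + h}"
    "F c \<le> F g + (\<Sum>i<K. \<bar>b i\<bar> * h\<^sup>2 / 4)"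
    using Suc.IH less_imp_le by blast
  obtain g' r where q: "\<And>t. F (g(K := t)) = b K * t\<^sup>2 + g' * t + r" using F[OF K, of g] by blast
  have x: "h * real_of_int \<lfloor>c K / h\<rfloor> \<le> c K" "c K \<le> h * real_of_int \<lfloor>c K / h\<rfloor> + h"
  proof -
    have "real_of_int \<lfloor>c K / h\<rfloor> * h \<le> c K / h * h" "c K / h * h \<le> (real_of_int \<lfloor>c K / h\<rfloor> + 1) * h"
      using h by (intro mult_right_mono; linarith)+
    then show "h * real_of_int \<lfloor>c K / h\<rfloor> \<le> c K" "c K \<le> h * real_of_int \<lfloor>c K / h\<rfloor> + h"
      using h by (simp_all add: algebra_simps)
  qed
  obtain s where s: "s \<in> {h * real_of_int \<lfloor>c K / h\<rfloor>, h * real_of_int \<lfloor>c K / h\<rfloor> + h}"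
      "F (g(K := c K)) \<le> F (g(K := s)) + \<bar>b K\<bar> * h\<^sup>2 / 4"
    using quadratic_le_endpoint[OF q x h] by blast
  have "g(K := c K) = g" using g(1) by auto
  then have "F c \<le> F (g(K := s)) + (\<Sum>i<Suc K. \<bar>b i\<bar> * h\<^sup>2 / 4)" using g(3) s(2) by simp
  moreover have "\<forall>i\<ge>Suc K. (g(K := s)) i = c i" using g(1) by simp
  moreover have "\<forall>i<Suc K. (g(K := s)) i \<in> {h * real_of_int \<lfloor>c i / h\<rfloor>, h * real_of_int \<lfloor>c i / h\<rfloor> + h}"
    using g(2) s(1) by (simp add: less_Suc_eq)
  ultimately show ?case by blast
qed

text \<open>A point of the unit sphere is rounded coordinate by coordinate to the lattice
  \<open>\<int>\<^sup>D / sqrt D\<close>. In each coordinate the form is a quadratic polynomial with leading coefficient at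
  most \<open>\<tau>\<close>, so one of the two roundings loses at most \<open>\<tau> / (4 D)\<close>.\<close>
lemma quadratic_form_net_bound_upper:
  fixes F :: "(nat \<Rightarrow> real) \<Rightarrow> real"
  assumes hom: "\<And>t c. F (\<lambda>j. t * c j) = t\<^sup>2 * F c"
    and loc: "\<And>c c'. (\<And>j. j < D \<Longrightarrow> c j = c' j) \<Longrightarrow> F c = F c'"
    and quad: "\<And>c i. i < D \<Longrightarrow> \<exists>g r. \<forall>t. F (c(i := t)) = F (\<lambda>j. of_bool (j = i)) * t\<^sup>2 + g * t + r"
    and net: "\<And>a. a \<in> int_net D \<Longrightarrow> \<bar>F (\<lambda>j. real_of_int (a j))\<bar> \<le> \<tau> * (\<Sum>j<D. (real_of_int (a j))\<^sup>2)"
    and "\<tau> \<ge> 0"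
  shows "F c \<le> 5 * \<tau> * (\<Sum>j<D. (c j)\<^sup>2)"
proof (cases "(\<Sum>j<D. (c j)\<^sup>2) = 0")
  case True
  then have "F c = F (\<lambda>j. 0 * c j)" by (intro loc) (simp add: sum_nonneg_eq_0_iff)
  also have "\<dots> = 0" by (subst hom) simp
  finally show ?thesis using True by simp
next
  case False
  define S where "S = (\<Sum>j<D. (c j)\<^sup>2)"
  have S: "S > 0" using False by (simp add: S_def sum_nonneg order_less_le)
  have D: "D > 0" using False by (cases D) auto
  define h where "h = 1 / sqrt (real D)"
  have h: "h > 0" "h\<^sup>2 = 1 / real D" using D by (auto simp: h_def power_divide)
  define c1 where "c1 = (\<lambda>j. 1 / sqrt S * c j)"
  have c1: "(\<Sum>j<D. (c1 j)\<^sup>2) = 1"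
    using S by (simp add: c1_def power_divide S_def flip: sum_divide_distrib)
  have "c = (\<lambda>j. sqrt S * c1 j)" using S by (auto simp: c1_def)
  then have Fc: "F c = S * F c1" using hom[of "sqrt S" c1] S by simp
  have Fi: "\<bar>F (\<lambda>j. of_bool (j = i))\<bar> \<le> \<tau>" if "i < D" for i
  proof -
    \<comment> \<open>A standard basis vector is itself a net point, which bounds the leading
      coefficient in every coordinate.\<close>
    define a where "a = (\<lambda>j\<in>{..<D}. of_bool (j = i) :: int)"
    have "(\<Sum>j<D. \<bar>a j\<bar>) = (\<Sum>j<D. of_bool (j = i))" by (intro sum.cong) (auto simp: a_def)
    also have "\<dots> = 1" using that by simp
    finally have "a \<in> int_net D" using D by (auto simp: int_net_def a_def)
    then have "\<bar>F (\<lambda>j. real_of_int (a j))\<bar> \<le> \<tau> * (\<Sum>j<D. (real_of_int (a j))\<^sup>2)" by (rule net)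
    also have "F (\<lambda>j. real_of_int (a j)) = F (\<lambda>j. of_bool (j = i))" by (rule loc) (simp add: a_def)
    also have "(\<Sum>j<D. (real_of_int (a j))\<^sup>2) = (\<Sum>j<D. of_bool (j = i))"
      by (intro sum.cong) (auto simp: a_def)
    also have "\<dots> = 1" using that by simp
    finally show ?thesis by simp
  qed
  obtain g where g: "\<And>i. i < D \<Longrightarrow> g i \<in> {h * real_of_int \<lfloor>c1 i / h\<rfloor>, h * real_of_int \<lfloor>c1 i / h\<rfloor> + h}"
    and Fg: "F c1 \<le> F g + (\<Sum>i<D. \<bar>F (\<lambda>j. of_bool (j = i))\<bar> * h\<^sup>2 / 4)"
    using coordinatewise_quadratic_round[where c = c1 and b = "\<lambda>i. F (\<lambda>j. of_bool (j = i))", OF quad h(1) order_refl]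
    by blast
  define a where "a = (\<lambda>j\<in>{..<D}. if g j = h * real_of_int \<lfloor>c1 j / h\<rfloor> then \<lfloor>c1 j / h\<rfloor> else \<lfloor>c1 j / h\<rfloor> + 1)"
  have ga: "g j = h * real_of_int (a j)" if "j < D" for j
    using g[OF that] that by (auto simp: a_def algebra_simps)
  \<comment> \<open>Rounding moves sqrt D times \<open>c1 j\<close> by at most 1, and (x + d)^2
    \<le> 2 x^2 + 2 d^2. Summed over a unit vector this gives 2 D + 2 D, the radius of the
    net.\<close>
  have a_sq: "(real_of_int (a j))\<^sup>2 \<le> 2 * real D * (c1 j)\<^sup>2 + 2" if "j < D" for j
  proof -
    define d where "d = real_of_int (a j) - c1 j / h"
    have "\<bar>d\<bar> \<le> 1" using that unfolding a_def d_def by (simp; linarith)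
    then have "d\<^sup>2 \<le> 1" by (simp add: abs_square_le_1)
    have "(real_of_int (a j))\<^sup>2 = (d + c1 j / h)\<^sup>2" by (simp add: d_def)
    also have "\<dots> \<le> 2 * d\<^sup>2 + 2 * (c1 j / h)\<^sup>2"
      using sum_squares_bound[of d "c1 j / h"] by (simp add: power2_sum)
    also have "(c1 j / h)\<^sup>2 = real D * (c1 j)\<^sup>2" using h D by (simp add: power_divide)
    finally show ?thesis using \<open>d\<^sup>2 \<le> 1\<close> by simp
  qed
  have "(\<Sum>j<D. (real_of_int (a j))\<^sup>2) \<le> (\<Sum>j<D. 2 * real D * (c1 j)\<^sup>2 + 2)"
    using a_sq by (intro sum_mono) simp
  also have "\<dots> = 4 * real D"
    using c1 by (simp add: sum.distrib flip: sum_distrib_left)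
  finally have a4: "(\<Sum>j<D. (real_of_int (a j))\<^sup>2) \<le> 4 * real D" .
  have abs_le_sq: "\<bar>x\<bar> \<le> x\<^sup>2" for x :: int
  proof (cases "x = 0")
    case False
    then have "\<bar>x\<bar> * 1 \<le> \<bar>x\<bar> * \<bar>x\<bar>" by (intro mult_left_mono) auto
    then show ?thesis by (simp add: power2_eq_square)
  qed simp
  have "(\<Sum>j<D. \<bar>a j\<bar>) \<le> (\<Sum>j<D. (a j)\<^sup>2)" by (intro sum_mono abs_le_sq)
  moreover have "real_of_int (\<Sum>j<D. (a j)\<^sup>2) \<le> real_of_int (int (4 * D))" using a4 by simp
  ultimately have a1: "(\<Sum>j<D. \<bar>a j\<bar>) \<le> int (4 * D)" by linarith
  have "\<bar>a j\<bar> \<le> int (4 * D)" if "j < D" for j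
    using member_le_sum[of j "{..<D}" "\<lambda>j. \<bar>a j\<bar>"] that a1 by simp
  then have "a j \<in> {- int (4 * D)..int (4 * D)}" if "j < D" for j
    using that by (simp add: abs_le_iff) fastforce
  moreover have "a j = undefined" if "\<not> j < D" for j using that by (simp add: a_def)
  ultimately have "a \<in> int_net D" using a1 by (auto simp: int_net_def PiE_iff extensional_def)
  then have Fa: "\<bar>F (\<lambda>j. real_of_int (a j))\<bar> \<le> \<tau> * (4 * real D)"
    using net[of a] mult_left_mono[OF a4 \<open>\<tau> \<ge> 0\<close>] by linarith
  have "F g = F (\<lambda>j. h * real_of_int (a j))" using ga by (intro loc) simp
  also have "\<dots> = h\<^sup>2 * F (\<lambda>j. real_of_int (a j))" by (rule hom)
  also have "\<dots> \<le> h\<^sup>2 * (\<tau> * (4 * real D))" using Fa by (intro mult_left_mono) auto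
  also have "\<dots> = 4 * \<tau>" using h D by simp
  finally have "F g \<le> 4 * \<tau>" .
  moreover have "(\<Sum>i<D. \<bar>F (\<lambda>j. of_bool (j = i))\<bar> * h\<^sup>2 / 4) \<le> (\<Sum>i<D. \<tau> * h\<^sup>2 / 4)"
    using Fi by (intro sum_mono divide_right_mono mult_right_mono) auto
  moreover have "(\<Sum>i<D. \<tau> * h\<^sup>2 / 4) = \<tau> / 4" using h D by simp
  \<comment> \<open>The value 4 \<tau> at the rounded point plus the total rounding loss \<tau> / 4:
    the origin of the factor 5.\<close>
  ultimately have "F c1 \<le> 5 * \<tau>" using Fg \<open>\<tau> \<ge> 0\<close> by linarith
  then have "S * F c1 \<le> S * (5 * \<tau>)" using S by (intro mult_left_mono) auto
  then show ?thesis unfolding Fc S_def[symmetric] by (simp add: mult_ac)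
qed

lemma quadratic_form_net_bound:
  fixes F :: "(nat \<Rightarrow> real) \<Rightarrow> real"
  assumes hom: "\<And>t c. F (\<lambda>j. t * c j) = t\<^sup>2 * F c"
    and loc: "\<And>c c'. (\<And>j. j < D \<Longrightarrow> c j = c' j) \<Longrightarrow> F c = F c'"
    and quad: "\<And>c i. i < D \<Longrightarrow> \<exists>g r. \<forall>t. F (c(i := t)) = F (\<lambda>j. of_bool (j = i)) * t\<^sup>2 + g * t + r"
    and net: "\<And>a. a \<in> int_net D \<Longrightarrow> \<bar>F (\<lambda>j. real_of_int (a j))\<bar> \<le> \<tau> * (\<Sum>j<D. (real_of_int (a j))\<^sup>2)"
    and "\<tau> \<ge> 0"
  shows "\<bar>F c\<bar> \<le> 5 * \<tau> * (\<Sum>j<D. (c j)\<^sup>2)"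
proof -
  have "F c \<le> 5 * \<tau> * (\<Sum>j<D. (c j)\<^sup>2)"
    by (rule quadratic_form_net_bound_upper[OF hom loc quad net \<open>\<tau> \<ge> 0\<close>])
  moreover have "- F c \<le> 5 * \<tau> * (\<Sum>j<D. (c j)\<^sup>2)"
  proof (rule quadratic_form_net_bound_upper[where F = "\<lambda>c. - F c"])
    fix c i assume "i < D"
    then obtain g r where "\<And>t. F (c(i := t)) = F (\<lambda>j. of_bool (j = i)) * t\<^sup>2 + g * t + r"
      using quad by blast
    then have "\<forall>t. - F (c(i := t)) = - F (\<lambda>j. of_bool (j = i)) * t\<^sup>2 + (- g) * t + (- r)" by simp
    then show "\<exists>g r. \<forall>t. - F (c(i := t)) = - F (\<lambda>j. of_bool (j = i)) * t\<^sup>2 + g * t + r" by blast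
  next
    show "- F (\<lambda>j. t * c j) = t\<^sup>2 * - F c" for t c by (simp add: hom)
    show "- F c = - F c'" if "\<And>j. j < D \<Longrightarrow> c j = c' j" for c c'
      using loc[of c c', OF that] by simp
    show "\<bar>- F (\<lambda>j. real_of_int (a j))\<bar> \<le> \<tau> * (\<Sum>j<D. (real_of_int (a j))\<^sup>2)" if "a \<in> int_net D" for a
      using net[OF that] by simp
  qed fact
  ultimately show ?thesis by linarith
qed

text \<open>Squared norms are compared, so that the defect is a quadratic form in
  \<open>u\<close>.\<close>

definition near_isometric :: "nat \<Rightarrow> nat \<Rightarrow> (nat \<times> nat \<Rightarrow> real) \<Rightarrow> real \<Rightarrow> (nat \<Rightarrow> real) \<Rightarrow> bool" where
  "near_isometric m n A \<tau> u \<longleftrightarrow>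
     \<bar>dot m (matvec m n A u) (matvec m n A u) - dot n u u\<bar> \<le> \<tau> * dot n u u"

lemma matvec_lincomb: "matvec m n A (lincomb D e c) = lincomb D (\<lambda>j. matvec m n A (e j)) c"
proof
  fix i
  have "(\<Sum>h<n. A (i, h) * (\<Sum>j<D. c j * e j h)) = (\<Sum>j<D. c j * (\<Sum>h<n. A (i, h) * e j h))"
    unfolding sum_distrib_left by (subst sum.swap) (simp add: mult_ac)
  then show "matvec m n A (lincomb D e c) i = lincomb D (\<lambda>j. matvec m n A (e j)) c i"
    by (simp add: matvec_def lincomb_def)
qed

text \<open>In orthonormal coordinates the squared norm is the sum of the squared coefficients, so
  the net bound for quadratic forms applies to the defect as a function of the coefficients.\<close>

lemma near_isometric_span:
  assumes e: "orthonormal n D e" and "\<tau> \<ge> 0"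
    and net: "\<And>a. a \<in> int_net D \<Longrightarrow> near_isometric m n A \<tau> (lincomb D e (\<lambda>j. real_of_int (a j)))"
  shows "near_isometric m n A (5 * \<tau>) (lincomb D e c)"
proof -
  define Y where "Y = (\<lambda>j. matvec m n A (e j))"
  define F where "F = (\<lambda>c. (\<Sum>i<m. (\<Sum>j<D. c j * Y j i)\<^sup>2) - (\<Sum>j<D. (c j)\<^sup>2))"
  have F: "F c = dot m (matvec m n A (lincomb D e c)) (matvec m n A (lincomb D e c))
      - dot n (lincomb D e c) (lincomb D e c)" for c
    unfolding matvec_lincomb dot_self_lincomb_orthonormal[OF e] F_def
    by (simp add: dot_def lincomb_def Y_def power2_eq_square)
  have "\<bar>F c\<bar> \<le> 5 * \<tau> * (\<Sum>j<D. (c j)\<^sup>2)"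
  proof (rule quadratic_form_net_bound)
    show "F (\<lambda>j. t * c j) = t\<^sup>2 * F c" for t c
    proof -
      have "(\<Sum>j<D. t * c j * Y j i) = t * (\<Sum>j<D. c j * Y j i)" for i
        by (simp add: sum_distrib_left mult.assoc)
      moreover have "(\<Sum>j<D. (t * c j)\<^sup>2) = t\<^sup>2 * (\<Sum>j<D. (c j)\<^sup>2)"
        by (simp add: sum_distrib_left power_mult_distrib)
      ultimately show ?thesis
        by (simp add: F_def power_mult_distrib right_diff_distrib flip: sum_distrib_left)
    qed
    show "F c = F c'" if "\<And>j. j < D \<Longrightarrow> c j = c' j" for c c'
      using that by (simp add: F_def)
    show "\<exists>g r. \<forall>t. F (c(k := t)) = F (\<lambda>j. of_bool (j = k)) * t\<^sup>2 + g * t + r" if k: "k < D" for c k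
    proof -
      define J where "J = {..<D} - {k}"
      have J: "{..<D} = insert k J" "k \<notin> J" "finite J" using k by (auto simp: J_def)
      define s where "s = (\<lambda>i. \<Sum>j\<in>J. c j * Y j i)"
      have 1: "(\<Sum>j<D. (c(k := t)) j * Y j i) = t * Y k i + s i" for t i
      proof -
        have "(\<Sum>j\<in>J. (c(k := t)) j * Y j i) = s i"
          unfolding s_def using J(2) by (intro sum.cong) auto
        then show ?thesis unfolding J(1) using J(2,3) by simp
      qed
      have 2: "(\<Sum>j<D. ((c(k := t)) j)\<^sup>2) = t\<^sup>2 + (\<Sum>j\<in>J. (c j)\<^sup>2)" for t
      proof -
        have "(\<Sum>j\<in>J. ((c(k := t)) j)\<^sup>2) = (\<Sum>j\<in>J. (c j)\<^sup>2)"
          using J(2) by (intro sum.cong) auto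
        then show ?thesis unfolding J(1) using J(2,3) by simp
      qed
      have 3: "F (\<lambda>j. of_bool (j = k)) = (\<Sum>i<m. (Y k i)\<^sup>2) - 1"
      proof -
        have "(\<Sum>j<D. of_bool (j = k) * Y j i) = (\<Sum>j<D. if j = k then Y j i else 0)" for i
          by (intro sum.cong) auto
        moreover have "(\<Sum>j<D. (of_bool (j = k))\<^sup>2 :: real) = (\<Sum>j<D. if j = k then 1 else 0)"
          by (intro sum.cong) auto
        ultimately show ?thesis using k by (simp add: F_def)
      qed
      have "F (c(k := t)) = F (\<lambda>j. of_bool (j = k)) * t\<^sup>2 + (\<Sum>i<m. 2 * Y k i * s i) * t
          + ((\<Sum>i<m. (s i)\<^sup>2) - (\<Sum>j\<in>J. (c j)\<^sup>2))" for t
      proof -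
        have "(\<Sum>i<m. (t * Y k i + s i)\<^sup>2)
            = (\<Sum>i<m. (Y k i)\<^sup>2) * t\<^sup>2 + (\<Sum>i<m. 2 * Y k i * s i) * t + (\<Sum>i<m. (s i)\<^sup>2)"
          unfolding sum_distrib_right sum.distrib[symmetric]
          by (intro sum.cong refl) (simp add: power2_sum power_mult_distrib)
        then show ?thesis unfolding 3 unfolding F_def 1 2 by (simp add: algebra_simps)
      qed
      then show ?thesis by blast
    qed
    show "\<bar>F (\<lambda>j. real_of_int (a j))\<bar> \<le> \<tau> * (\<Sum>j<D. (real_of_int (a j))\<^sup>2)" if "a \<in> int_net D" for a
      using net[OF that] unfolding near_isometric_def F dot_self_lincomb_orthonormal[OF e] .
  qed fact
  then show ?thesis
    unfolding near_isometric_def F dot_self_lincomb_orthonormal[OF e] .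
qed

section \<open>Gaussian concentration\<close>

text \<open>The integrand is a constant multiple of the normal density of variance \<sigma>^2 / b,
  where b = 1 - 2 s \<sigma>^2.\<close>

lemma nn_integral_normal_exp_square:
  assumes "\<sigma> > 0" and "2 * s * \<sigma>\<^sup>2 < 1"
  shows "(\<integral>\<^sup>+x. ennreal (normal_density 0 \<sigma> x) * ennreal (exp (s * x\<^sup>2)) \<partial>lborel)
           = ennreal (1 / sqrt (1 - 2 * s * \<sigma>\<^sup>2))"
proof -
  define b where "b = 1 - 2 * s * \<sigma>\<^sup>2"
  have b: "b > 0" using assms by (simp add: b_def)
  have sb: "sqrt b > 0" "(sqrt b)\<^sup>2 = b" using b by auto
  have eq: "normal_density 0 \<sigma> x * exp (s * x\<^sup>2) = 1 / sqrt b * normal_density 0 (\<sigma> / sqrt b) x" for x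
  proof -
    have "- x\<^sup>2 / (2 * \<sigma>\<^sup>2) + s * x\<^sup>2 = - x\<^sup>2 / (2 * (\<sigma> / sqrt b)\<^sup>2)"
      using assms(1) b by (simp add: power_divide b_def field_simps)
    then have "exp (- x\<^sup>2 / (2 * \<sigma>\<^sup>2)) * exp (s * x\<^sup>2) = exp (- x\<^sup>2 / (2 * (\<sigma> / sqrt b)\<^sup>2))"
      by (simp flip: exp_add)
    moreover have "sqrt (2 * pi * (\<sigma> / sqrt b)\<^sup>2) = sqrt (2 * pi * \<sigma>\<^sup>2) / sqrt b"
      using b by (simp add: power_divide real_sqrt_divide)
    ultimately show ?thesis using sb(1) assms(1) unfolding normal_density_def by simp
  qed
  have "(\<integral>\<^sup>+x. ennreal (normal_density 0 \<sigma> x) * ennreal (exp (s * x\<^sup>2)) \<partial>lborel)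
      = (\<integral>\<^sup>+x. ennreal (1 / sqrt b) * ennreal (normal_density 0 (\<sigma> / sqrt b) x) \<partial>lborel)"
    using sb by (intro nn_integral_cong) (simp add: eq flip: ennreal_mult')
  also have "\<dots> = ennreal (1 / sqrt b) * (\<integral>\<^sup>+x. ennreal (normal_density 0 (\<sigma> / sqrt b) x) \<partial>lborel)"
    by (rule nn_integral_cmult) simp
  also have "(\<integral>\<^sup>+x. ennreal (normal_density 0 (\<sigma> / sqrt b) x) \<partial>lborel) = 1"
    using assms(1) sb(1) by (simp add: nn_integral_eq_integral normal_density_nonneg)
  finally show ?thesis by (simp add: b_def)
qed

section \<open>Joint law of the entries and rows of the Gaussian matrix\<close>

lemma prob_space_gauss_mat:
  assumes "m > 0" shows "prob_space (gauss_mat m n)"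
  unfolding gauss_mat_def using assms by (intro prob_space_PiM prob_space_normal_density) simp

lemma distributed_gauss_mat_entry:
  assumes "m > 0" "p \<in> {..<m} \<times> {..<n}"
  shows "distributed (gauss_mat m n) lborel (\<lambda>A. A p) (normal_density 0 (1 / sqrt (real m)))"
proof -
  define N where "N = density lborel (normal_density 0 (1 / sqrt (real m)))"
  have N: "prob_space N" unfolding N_def using assms(1) by (intro prob_space_normal_density) simp
  have g: "gauss_mat m n = PiM ({..<m} \<times> {..<n}) (\<lambda>_. N)" by (simp add: gauss_mat_def N_def)
  have sN: "sets N = sets lborel" by (simp add: N_def)
  have "(\<lambda>A. A p) \<in> measurable (gauss_mat m n) N"
    unfolding g using assms(2) by (rule measurable_component_singleton)
  then have "(\<lambda>A. A p) \<in> measurable (gauss_mat m n) lborel"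
    using measurable_cong_sets[OF refl sN] by blast
  moreover have "distr (gauss_mat m n) lborel (\<lambda>A. A p) = distr (gauss_mat m n) N (\<lambda>A. A p)"
    by (rule distr_cong) (auto simp: sN)
  moreover have "\<dots> = N" unfolding g using N assms(2) by (intro distr_PiM_component) auto
  ultimately show ?thesis by (simp add: distributed_def N_def)
qed

lemma indep_vars_gauss_mat_entries:
  assumes "m > 0" "n > 0"
  shows "prob_space.indep_vars (gauss_mat m n) (\<lambda>_. borel) (\<lambda>p A. A p) ({..<m} \<times> {..<n})"
proof -
  interpret prob_space "gauss_mat m n" by (rule prob_space_gauss_mat) fact
  let ?I = "{..<m} \<times> {..<n}"
  define N where "N = density lborel (normal_density 0 (1 / sqrt (real m)))"
  have g: "gauss_mat m n = PiM ?I (\<lambda>_. N)" by (simp add: gauss_mat_def N_def)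
  note entry = distributed_gauss_mat_entry[OF assms(1), of _ n]
  have sb: "sets (PiM ?I (\<lambda>_. borel)) = sets (gauss_mat m n)"
    unfolding g by (intro sets_PiM_cong) (auto simp: N_def)
  show ?thesis
  proof (subst indep_vars_iff_distr_eq_PiM')
    show "?I \<noteq> {}" using assms by auto
    show "(\<lambda>A. A p) \<in> borel_measurable (gauss_mat m n)" if "p \<in> ?I" for p
      using distributed_measurable[OF entry[OF that]] by simp
    \<comment> \<open>Points of the space are extensional on the index set, so the joint map is the
      identity and its law is the product measure itself, read over the Borel sets.\<close>
    have "distr (gauss_mat m n) (PiM ?I (\<lambda>_. borel)) (\<lambda>x. \<lambda>i\<in>?I. x i) = distr (gauss_mat m n) (gauss_mat m n) (\<lambda>x. x)"
    proof (rule distr_cong)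
      fix x assume "x \<in> space (gauss_mat m n)"
      then have "x \<in> extensional ?I" by (auto simp: g space_PiM PiE_def)
      then show "restrict x ?I = x" by (rule extensional_restrict)
    qed (simp_all add: sb)
    also have "\<dots> = gauss_mat m n" by (rule distr_id2) simp
    also have "\<dots> = PiM ?I (\<lambda>p. distr (gauss_mat m n) borel (\<lambda>A. A p))"
      unfolding g
    proof (rule PiM_cong)
      fix p assume "p \<in> ?I"
      then have "distr (gauss_mat m n) lborel (\<lambda>A. A p) = N"
        using distributed_distr_eq_density[OF entry] by (simp add: N_def)
      moreover have "distr (gauss_mat m n) borel (\<lambda>A. A p) = distr (gauss_mat m n) lborel (\<lambda>A. A p)"
        by (rule distr_cong) auto
      ultimately show "N = distr (PiM ?I (\<lambda>_. N)) borel (\<lambda>A. A p)" by (simp add: g)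
    qed simp
    finally show "distr (gauss_mat m n) (PiM ?I (\<lambda>_. borel)) (\<lambda>x. \<lambda>i\<in>?I. x i)
        = PiM ?I (\<lambda>p. distr (gauss_mat m n) borel (\<lambda>A. A p))" .
  qed
qed

lemma distributed_gauss_mat_row:
  assumes "m > 0" "i < m" and u: "dot n u u > 0"
  shows "distributed (gauss_mat m n) lborel (\<lambda>A. \<Sum>j<n. A (i, j) * u j)
           (normal_density 0 (sqrt (dot n u u / real m)))"
proof -
  interpret prob_space "gauss_mat m n" by (rule prob_space_gauss_mat) fact
  \<comment> \<open>Zero coefficients are discarded: they would give constants, which have no
    density, while the sum rule for normal variables asks for positive variances.\<close>
  define J where "J = {j. j < n \<and> u j \<noteq> 0}"
  have J: "finite J" "J \<subseteq> {..<n}" by (auto simp: J_def)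
  have "dot n u u = 0" if "J = {}"
    unfolding dot_def using that by (intro sum.neutral) (auto simp: J_def)
  then have "J \<noteq> {}" using u by auto
  have "n > 0" using u by (cases n) (auto simp: dot_def)
  have "indep_vars (\<lambda>_. borel) (\<lambda>p A. A p) (Pair i ` J)"
    using indep_vars_gauss_mat_entries[OF \<open>m > 0\<close> \<open>n > 0\<close>] J(2) \<open>i < m\<close>
    by (rule_tac indep_vars_subset) auto
  then have "indep_vars (\<lambda>_. borel) (\<lambda>p A. A p * u (snd p)) (Pair i ` J)"
    by (rule indep_vars_compose2[where Y = "\<lambda>p x. x * u (snd p)"]) simp
  moreover have "distributed (gauss_mat m n) lborel (\<lambda>A. A p * u (snd p))
      (normal_density 0 (\<bar>u (snd p)\<bar> * (1 / sqrt (real m))))" if "p \<in> Pair i ` J" for p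
  proof -
    have "p \<in> {..<m} \<times> {..<n}" "u (snd p) \<noteq> 0" using that J(2) \<open>i < m\<close> by (auto simp: J_def)
    then show ?thesis
      using normal_density_affine[OF distributed_gauss_mat_entry[OF \<open>m > 0\<close>, of p n], where \<alpha> = "u (snd p)" and \<beta> = 0]
        \<open>m > 0\<close>
      by (simp add: mult.commute)
  qed
  ultimately have "distributed (gauss_mat m n) lborel (\<lambda>A. \<Sum>p\<in>Pair i ` J. A p * u (snd p))
      (normal_density (\<Sum>p\<in>Pair i ` J. 0) (sqrt (\<Sum>p\<in>Pair i ` J. (\<bar>u (snd p)\<bar> * (1 / sqrt (real m)))\<^sup>2)))"
    using J \<open>J \<noteq> {}\<close> \<open>m > 0\<close> by (intro sum_indep_normal) (auto simp: J_def)
  moreover have inj: "inj_on (Pair i) J" by (simp add: inj_on_def)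
  moreover have "(\<Sum>j\<in>J. A (i, j) * u j) = (\<Sum>j<n. A (i, j) * u j)" for A :: "nat \<times> nat \<Rightarrow> real"
    by (rule sum.mono_neutral_left) (auto simp: J_def)
  moreover have "(\<Sum>j\<in>J. (\<bar>u j\<bar> * (1 / sqrt (real m)))\<^sup>2) = dot n u u / real m"
  proof -
    have "(\<Sum>j\<in>J. (u j)\<^sup>2) = (\<Sum>j<n. (u j)\<^sup>2)" by (rule sum.mono_neutral_left) (auto simp: J_def)
    then show ?thesis
      by (simp add: dot_def power_divide power2_eq_square flip: sum_divide_distrib)
  qed
  ultimately show ?thesis by (simp add: sum.reindex)
qed

lemma indep_vars_gauss_mat_rows:
  assumes "m > 0" "n > 0"
  shows "prob_space.indep_vars (gauss_mat m n) (\<lambda>_. borel) (\<lambda>i A. \<Sum>j<n. A (i, j) * u j) {..<m}"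
proof -
  interpret prob_space "gauss_mat m n" by (rule prob_space_gauss_mat) fact
  define K where "K = (\<lambda>i::nat. Pair i ` {..<n})"
  have "indep_vars (\<lambda>i. PiM (K i) (\<lambda>_. borel)) (\<lambda>i A. restrict (\<lambda>p. A p) (K i)) {..<m}"
    by (rule indep_vars_restrict[OF indep_vars_gauss_mat_entries[OF assms]])
       (auto simp: K_def disjoint_family_on_def)
  then have "indep_vars (\<lambda>_. borel) (\<lambda>i A. \<Sum>j<n. (restrict (\<lambda>p. A p) (K i)) (i, j) * u j) {..<m}"
  proof (rule indep_vars_compose2[where Y = "\<lambda>i x. \<Sum>j<n. x (i, j) * u j"])
    fix i
    show "(\<lambda>x. \<Sum>j<n. x (i, j) * u j) \<in> borel_measurable (PiM (K i) (\<lambda>_. borel :: real measure))"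
      by (intro borel_measurable_sum borel_measurable_times measurable_component_singleton
          borel_measurable_const) (auto simp: K_def)
  qed
  then show ?thesis by (simp add: K_def)
qed

text \<open>The rows applied to \<open>u\<close> are independent normal variables of variance
  \<open>dot n u u / m\<close>. The scaling of the exponent cancels this variance, leaving
  \<open>m\<close> factors of the chi-square moment generating function at \<kappa>.\<close>

lemma gauss_mat_mgf:
  assumes "m > 0" and u: "dot n u u > 0" and "\<kappa> < 1/2"
  shows "(\<integral>\<^sup>+A. ennreal (exp (real m * \<kappa> / dot n u u * (\<Sum>i<m. (\<Sum>j<n. A (i, j) * u j)\<^sup>2))) \<partial>gauss_mat m n)
          = ennreal ((1 / sqrt (1 - 2 * \<kappa>)) ^ m)"
proof -
  interpret prob_space "gauss_mat m n" by (rule prob_space_gauss_mat) fact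
  have "n > 0" using u by (cases n) (auto simp: dot_def)
  define s where "s = real m * \<kappa> / dot n u u"
  define Y where "Y = (\<lambda>(i::nat) A. \<Sum>j<n. A (i, j) * u j)"
  have "(\<integral>\<^sup>+A. ennreal (exp (s * (\<Sum>i<m. (Y i A)\<^sup>2))) \<partial>gauss_mat m n)
      = (\<integral>\<^sup>+A. (\<Prod>i<m. ennreal (exp (s * (Y i A)\<^sup>2))) \<partial>gauss_mat m n)"
    by (simp add: prod_ennreal exp_sum sum_distrib_left)
  also have "\<dots> = (\<Prod>i<m. \<integral>\<^sup>+A. ennreal (exp (s * (Y i A)\<^sup>2)) \<partial>gauss_mat m n)"
    using indep_vars_compose2[OF indep_vars_gauss_mat_rows[OF \<open>m > 0\<close> \<open>n > 0\<close>, of u],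
        of "\<lambda>_ x. ennreal (exp (s * x\<^sup>2))" "\<lambda>_. borel"]
    by (intro indep_vars_nn_integral) (auto simp: Y_def)
  also have "\<dots> = (\<Prod>i<m. ennreal (1 / sqrt (1 - 2 * \<kappa>)))"
  proof (rule prod.cong[OF refl])
    fix i assume "i \<in> {..<m}"
    then have "distributed (gauss_mat m n) lborel (Y i) (normal_density 0 (sqrt (dot n u u / real m)))"
      unfolding Y_def using distributed_gauss_mat_row[OF \<open>m > 0\<close> _ u] by simp
    then have "(\<integral>\<^sup>+A. ennreal (exp (s * (Y i A)\<^sup>2)) \<partial>gauss_mat m n)
      = (\<integral>\<^sup>+x. ennreal (normal_density 0 (sqrt (dot n u u / real m)) x) * ennreal (exp (s * x\<^sup>2)) \<partial>lborel)"
      by (subst distributed_nn_integral) auto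
    also have "\<dots> = ennreal (1 / sqrt (1 - 2 * s * (sqrt (dot n u u / real m))\<^sup>2))"
      using assms by (intro nn_integral_normal_exp_square) (auto simp: s_def)
    also have "2 * s * (sqrt (dot n u u / real m))\<^sup>2 = 2 * \<kappa>" using assms by (simp add: s_def)
    finally show "(\<integral>\<^sup>+A. ennreal (exp (s * (Y i A)\<^sup>2)) \<partial>gauss_mat m n) = ennreal (1 / sqrt (1 - 2 * \<kappa>))" .
  qed
  also have "\<dots> = ennreal ((1 / sqrt (1 - 2 * \<kappa>)) ^ m)"
    using assms by (simp add: ennreal_power)
  finally show ?thesis by (simp add: s_def Y_def)
qed

text \<open>The sign \<eta> selects the upper or the lower tail. A second-order bound on the
  logarithm reduces the exponent per row to 4 \<kappa>^2 - \<kappa> \<eta> t, minimised at \<kappa>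
  = \<eta> t / 8 with value - t^2 / 16; t \<le> 1 keeps \<kappa> in the range of that bound.\<close>

lemma chernoff_exponent:
  fixes t \<eta> :: real
  assumes "0 < t" "t \<le> 1" "\<bar>\<eta>\<bar> = 1" and \<kappa>: "\<kappa> = \<eta> * t / 8"
  shows "exp (- (real m * \<kappa> * (1 + \<eta> * t))) * (1 / sqrt (1 - 2 * \<kappa>)) ^ m \<le> exp (- (real m * t\<^sup>2 / 16))"
proof -
  have \<eta>2: "\<eta> * \<eta> = 1" using assms(3) by (metis abs_mult_self_eq mult_1)
  have l2: "\<kappa>\<^sup>2 = t\<^sup>2 / 64" unfolding \<kappa> using \<eta>2 by (simp add: power2_eq_square mult.assoc)
  have "\<bar>\<kappa>\<bar> = t / 8" unfolding \<kappa> using assms(1,3) by (simp add: abs_mult)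
  then have "\<bar>- 2 * \<kappa>\<bar> \<le> 1/2" using assms(2) by (simp add: abs_mult)
  then have 1: "\<bar>ln (1 + (- 2 * \<kappa>)) - (- 2 * \<kappa>)\<bar> \<le> 2 * (- 2 * \<kappa>)\<^sup>2"
    by (rule abs_ln_one_plus_x_minus_x_bound)
  have pos: "1 - 2 * \<kappa> > 0" using \<open>\<bar>- 2 * \<kappa>\<bar> \<le> 1/2\<close> by (simp add: abs_le_iff)
  define L where "L = ln (1 - 2 * \<kappa>)"
  have L: "- L / 2 \<le> \<kappa> + 4 * \<kappa>\<^sup>2" using 1 unfolding L_def by (simp add: abs_le_iff power_mult_distrib)
  have "1 / sqrt (1 - 2 * \<kappa>) = exp (- L / 2)"
    using pos by (simp add: L_def ln_sqrt exp_minus inverse_eq_divide flip: ln_sqrt)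
  then have "exp (- (real m * \<kappa> * (1 + \<eta> * t))) * (1 / sqrt (1 - 2 * \<kappa>)) ^ m
      = exp (real m * (- L / 2 - \<kappa> * (1 + \<eta> * t)))"
    by (simp add: algebra_simps flip: exp_of_nat_mult exp_add)
  also have "\<dots> \<le> exp (real m * (4 * \<kappa>\<^sup>2 - \<kappa> * \<eta> * t))"
    unfolding exp_le_cancel_iff using L by (intro mult_left_mono) (auto simp: algebra_simps)
  also have "4 * \<kappa>\<^sup>2 - \<kappa> * \<eta> * t = - (t\<^sup>2 / 16)"
    unfolding l2 \<kappa> using \<eta>2 by (simp add: power2_eq_square algebra_simps)
  finally show ?thesis by simp
qed

section \<open>Tail bounds for a fixed vector\<close>

lemma matvec_dot_eq: "dot m (matvec m n A u) (matvec m n A u) = (\<Sum>i<m. (\<Sum>j<n. A (i, j) * u j)\<^sup>2)"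
  by (simp add: dot_def matvec_def power2_eq_square)

lemma measurable_gauss_mat_dot:
  "(\<lambda>A. dot m (matvec m n A u) (matvec m n A u)) \<in> borel_measurable (gauss_mat m n)"
proof -
  have "(\<lambda>A. A p) \<in> borel_measurable (gauss_mat m n)" if "p \<in> {..<m} \<times> {..<n}" for p
    using measurable_component_singleton[OF that, of "\<lambda>_. density lborel (normal_density 0 (1 / sqrt (real m)))"]
    unfolding gauss_mat_def by simp
  then show ?thesis
    unfolding matvec_dot_eq
    by (intro borel_measurable_sum borel_measurable_power borel_measurable_times borel_measurable_const) auto
qed

lemma gauss_mat_one_sided_tail:
  assumes "m > 0" and u: "dot n u u > 0" and t: "0 < t" "t \<le> 1" and \<eta>: "\<bar>\<eta>\<bar> = 1"
  shows "measure (gauss_mat m n) {A \<in> space (gauss_mat m n).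
           \<eta> * (dot m (matvec m n A u) (matvec m n A u) - dot n u u) > t * dot n u u} \<le> exp (- (real m * t\<^sup>2 / 16))"
    (is "measure _ ?B \<le> _")
proof -
  interpret prob_space "gauss_mat m n" by (rule prob_space_gauss_mat) fact
  define v where "v = dot n u u"
  define X where "X = (\<lambda>A. dot m (matvec m n A u) (matvec m n A u))"
  have [measurable]: "X \<in> borel_measurable (gauss_mat m n)"
    unfolding X_def by (rule measurable_gauss_mat_dot)
  have v: "v > 0" using u by (simp add: v_def)
  define \<kappa> where "\<kappa> = \<eta> * t / 8"
  have "\<bar>\<kappa>\<bar> < 1/2" using t \<eta> by (simp add: \<kappa>_def abs_mult)
  then have \<kappa>: "\<kappa> < 1/2" by simp
  define w where "w = exp (- (real m * \<kappa> * (1 + \<eta> * t)))"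
  have eta2: "\<eta> * \<eta> = 1" using \<eta> by (metis abs_mult_self_eq mult_1)
  have B: "?B = {A \<in> space (gauss_mat m n). \<eta> * (X A - v) > t * v}" by (simp add: X_def v_def)
  have "emeasure (gauss_mat m n) ?B = (\<integral>\<^sup>+A. indicator ?B A \<partial>gauss_mat m n)"
    unfolding B by (subst nn_integral_indicator) auto
  \<comment> \<open>Markov's inequality, pointwise: on the event the combined exponent is m t / (8
    v) times the excess \<eta> (X A - v) - t v, hence nonnegative.\<close>
  also have "\<dots> \<le> (\<integral>\<^sup>+A. ennreal w * ennreal (exp (real m * \<kappa> / v * X A)) \<partial>gauss_mat m n)"
  proof (rule nn_integral_mono)
    fix A
    show "indicator ?B A \<le> ennreal w * ennreal (exp (real m * \<kappa> / v * X A))"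
    proof (cases "A \<in> ?B")
      case True
      then have "\<eta> * (X A - v) - t * v > 0" by (simp add: X_def v_def)
      then have "0 \<le> real m * t / (8 * v) * (\<eta> * (X A - v) - t * v)"
        using v t by (intro mult_nonneg_nonneg) auto
      also have "\<dots> = real m / v * (t / 8) * \<eta> * X A - real m * (t / 8) * \<eta> - real m * (t / 8) * (\<eta> * \<eta>) * t"
        unfolding eta2 using v by (simp add: field_simps)
      also have "\<dots> = real m * \<kappa> / v * X A - real m * \<kappa> * (1 + \<eta> * t)"
        by (simp add: \<kappa>_def algebra_simps)
      finally have "1 \<le> w * exp (real m * \<kappa> / v * X A)"
        by (simp add: w_def flip: exp_add)
      then show ?thesis using True by (simp add: w_def flip: ennreal_mult')
    qed simp
  qed
  also have "\<dots> = ennreal w * (\<integral>\<^sup>+A. ennreal (exp (real m * \<kappa> / v * X A)) \<partial>gauss_mat m n)"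
    by (rule nn_integral_cmult) measurable
  also have "(\<integral>\<^sup>+A. ennreal (exp (real m * \<kappa> / v * X A)) \<partial>gauss_mat m n) = ennreal ((1 / sqrt (1 - 2 * \<kappa>)) ^ m)"
    unfolding X_def matvec_dot_eq v_def by (rule gauss_mat_mgf[OF assms(1) u \<kappa>])
  also have "ennreal w * \<dots> = ennreal (w * (1 / sqrt (1 - 2 * \<kappa>)) ^ m)"
    by (simp add: w_def ennreal_mult')
  also have "\<dots> \<le> ennreal (exp (- (real m * t\<^sup>2 / 16)))"
    unfolding w_def using chernoff_exponent[OF t \<eta> \<kappa>_def, of m] by (rule ennreal_leI)
  finally show ?thesis by (simp add: emeasure_eq_measure)
qed

lemma gauss_mat_not_near_isometric:
  assumes "m > 0" and t: "0 < t" "t \<le> 1"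
  shows "{A \<in> space (gauss_mat m n). \<not> near_isometric m n A t u} \<in> sets (gauss_mat m n)" (is ?meas)
    and "measure (gauss_mat m n) {A \<in> space (gauss_mat m n). \<not> near_isometric m n A t u}
          \<le> 2 * exp (- (real m * t\<^sup>2 / 16))" (is ?bound)
proof -
  interpret prob_space "gauss_mat m n" by (rule prob_space_gauss_mat) fact
  define v where "v = dot n u u"
  define X where "X = (\<lambda>A. dot m (matvec m n A u) (matvec m n A u))"
  have [measurable]: "X \<in> borel_measurable (gauss_mat m n)"
    unfolding X_def by (rule measurable_gauss_mat_dot)
  have iso: "near_isometric m n A t u \<longleftrightarrow> \<bar>X A - v\<bar> \<le> t * v" for A
    by (simp add: near_isometric_def X_def v_def)
  show ?meas unfolding iso by measurable
  show ?bound
  \<comment> \<open>The moment computation divides by \<open>v\<close>; for \<open>v = 0\<close>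
    both sides of the near-isometry vanish and the bad event is empty.\<close>
  proof (cases "v = 0")
    case True
    have "u j = 0" if "j < n" for j
      using True that unfolding v_def dot_def by (subst (asm) sum_nonneg_eq_0_iff) auto
    then have "X A = 0" for A by (simp add: X_def matvec_dot_eq)
    then show ?thesis by (simp add: iso True)
  next
    case False
    then have v: "dot n u u > 0" by (simp add: v_def dot_def sum_nonneg order_less_le)
    let ?B = "\<lambda>\<eta>. {A \<in> space (gauss_mat m n). \<eta> * (X A - v) > t * v}"
    have "measure (gauss_mat m n) {A \<in> space (gauss_mat m n). \<not> near_isometric m n A t u}
        \<le> measure (gauss_mat m n) (?B 1 \<union> ?B (- 1))"
      by (intro finite_measure_mono) (auto simp: iso)
    also have "\<dots> \<le> measure (gauss_mat m n) (?B 1) + measure (gauss_mat m n) (?B (- 1))"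
      by (intro measure_Un_le) auto
    also have "\<dots> \<le> exp (- (real m * t\<^sup>2 / 16)) + exp (- (real m * t\<^sup>2 / 16))"
      unfolding X_def v_def
      by (intro add_mono gauss_mat_one_sided_tail[OF \<open>m > 0\<close> v t]) auto
    finally show ?thesis by simp
  qed
qed

section \<open>Recovery from near-isometry\<close>

definition restr :: "(nat \<Rightarrow> real) \<Rightarrow> nat set \<Rightarrow> nat \<Rightarrow> real" where
  "restr w T = (\<lambda>i. if i \<in> T then w i else 0)"

lemma top_subset_exists:
  fixes w :: "'a \<Rightarrow> real"
  assumes "finite S" "s \<le> card S"
  shows "\<exists>T\<subseteq>S. card T = s \<and> (\<forall>i\<in>T. \<forall>j\<in>S - T. w j \<le> w i)"
  using assms(2)
proof (induction s)
  case 0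
  show ?case by (intro exI[of _ "{}"]) auto
next
  case (Suc s)
  then obtain T where T: "T \<subseteq> S" "card T = s" "\<forall>i\<in>T. \<forall>j\<in>S - T. w j \<le> w i" by auto
  have finT: "finite T" using T(1) assms(1) finite_subset by blast
  have "card (S - T) > 0" using Suc.prems T finT by (simp add: card_Diff_subset)
  then have "S - T \<noteq> {}" "finite (S - T)" using assms(1) by (auto simp: card_gt_0_iff)
  then obtain p where p: "p \<in> S - T" "\<forall>j\<in>S - T. w j \<le> w p"
    using obtains_MAX[of "S - T" w] by (metis Max_ge finite_imageI imageI)
  show ?case
    using T p finT by (intro exI[of _ "insert p T"]) auto
qed

text \<open>Every entry on \<open>T'\<close> is at most the average of \<bar>w\<bar> over
  \<open>T\<close>, and at most \<open>s\<close> such entries have l2 norm at most sqrt s times that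
  average.\<close>

lemma l2_le_of_dominated:
  fixes w :: "'a \<Rightarrow> real"
  assumes "s > 0" "finite T" "card T = s" "finite T'" "card T' \<le> s"
    and dom: "\<And>i j. i \<in> T \<Longrightarrow> j \<in> T' \<Longrightarrow> \<bar>w j\<bar> \<le> \<bar>w i\<bar>"
  shows "sqrt (\<Sum>j\<in>T'. (w j)\<^sup>2) \<le> (\<Sum>i\<in>T. \<bar>w i\<bar>) / sqrt (real s)"
proof -
  define M where "M = (\<Sum>i\<in>T. \<bar>w i\<bar>) / real s"
  have "M \<ge> 0" by (simp add: M_def sum_nonneg)
  have le: "\<bar>w j\<bar> \<le> M" if "j \<in> T'" for j
  proof -
    have "(\<Sum>i\<in>T. \<bar>w j\<bar>) \<le> (\<Sum>i\<in>T. \<bar>w i\<bar>)" using dom that by (intro sum_mono) auto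
    then show ?thesis using assms(1,3) by (simp add: M_def field_simps)
  qed
  have "(\<Sum>j\<in>T'. (w j)\<^sup>2) \<le> (\<Sum>j\<in>T'. M\<^sup>2)"
    using le \<open>M \<ge> 0\<close> by (intro sum_mono) (metis abs_ge_zero power2_abs power_mono)
  also have "\<dots> \<le> real s * M\<^sup>2" using assms(5) by (simp add: mult_right_mono)
  finally have "sqrt (\<Sum>j\<in>T'. (w j)\<^sup>2) \<le> sqrt (real s * M\<^sup>2)" by (rule real_sqrt_le_mono)
  also have "\<dots> = sqrt (real s) * M" using \<open>M \<ge> 0\<close> by (simp add: real_sqrt_mult)
  also have "\<dots> = (\<Sum>i\<in>T. \<bar>w i\<bar>) / sqrt (real s)"
    using assms(1) by (simp add: M_def field_simps)
  finally show ?thesis .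
qed

text \<open>The complement of the dominating set is split into consecutive blocks of \<open>s\<close> largest
  entries; the \<open>\<ell>\<^sub>2\<close> norm of each block is paid for by the \<open>\<ell>\<^sub>1\<close> norm of the preceding one.\<close>
lemma seminorm_tail_bound:
  fixes N :: "(nat \<Rightarrow> real) \<Rightarrow> real"
  assumes sub: "\<And>x y. N (\<lambda>i. x i + y i) \<le> N x + N y"
    and "s > 0" "\<kappa> \<ge> 0"
    and bd: "\<And>R. finite R \<Longrightarrow> R \<subseteq> U \<Longrightarrow> card R \<le> s \<Longrightarrow> N (restr w R) \<le> \<kappa> * sqrt (\<Sum>i\<in>R. (w i)\<^sup>2)"
    and "finite S" "S \<subseteq> U" "T \<subseteq> S" "card T = s" "\<forall>i\<in>T. \<forall>j\<in>S - T. \<bar>w j\<bar> \<le> \<bar>w i\<bar>"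
  shows "N (restr w (S - T)) \<le> \<kappa> / sqrt (real s) * (\<Sum>i\<in>S. \<bar>w i\<bar>)"
  using assms(5-)
proof (induction "card S" arbitrary: S T rule: less_induct)
  case less
  define S' where "S' = S - T"
  have fin: "finite S'" "finite T" using less.prems by (auto simp: S'_def intro: finite_subset)
  have sub': "S' \<subseteq> U" using less.prems by (auto simp: S'_def)
  have split: "(\<Sum>i\<in>S. \<bar>w i\<bar>) = (\<Sum>i\<in>T. \<bar>w i\<bar>) + (\<Sum>i\<in>S'. \<bar>w i\<bar>)"
    unfolding S'_def using less.prems by (simp add: sum.subset_diff)
  have block: "N (restr w R) \<le> \<kappa> / sqrt (real s) * (\<Sum>i\<in>T. \<bar>w i\<bar>)" if "R \<subseteq> S'" "card R \<le> s" for R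
  proof -
    have "finite R" using that fin finite_subset by blast
    then have "N (restr w R) \<le> \<kappa> * sqrt (\<Sum>i\<in>R. (w i)\<^sup>2)" using bd that sub' by blast
    also have "\<dots> \<le> \<kappa> * ((\<Sum>i\<in>T. \<bar>w i\<bar>) / sqrt (real s))"
    proof (rule mult_left_mono[OF l2_le_of_dominated \<open>\<kappa> \<ge> 0\<close>])
      show "\<bar>w j\<bar> \<le> \<bar>w i\<bar>" if "i \<in> T" "j \<in> R" for i j
        using less.prems(5) that \<open>R \<subseteq> S'\<close> by (auto simp: S'_def)
    qed (use \<open>s > 0\<close> fin less.prems(4) \<open>finite R\<close> that in auto)
    finally show ?thesis by simp
  qed
  show ?case
  proof (cases "card S' \<le> s")
    case True
    have "N (restr w S') \<le> \<kappa> / sqrt (real s) * (\<Sum>i\<in>T. \<bar>w i\<bar>)" using block[OF order_refl True] .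
    also have "\<dots> \<le> \<kappa> / sqrt (real s) * (\<Sum>i\<in>S. \<bar>w i\<bar>)"
      unfolding split using \<open>\<kappa> \<ge> 0\<close> by (intro mult_left_mono) (auto simp: sum_nonneg)
    finally show ?thesis by (simp add: S'_def)
  next
    case False
    then obtain T' where T': "T' \<subseteq> S'" "card T' = s" "\<forall>i\<in>T'. \<forall>j\<in>S' - T'. \<bar>w j\<bar> \<le> \<bar>w i\<bar>"
      using top_subset_exists[OF fin(1), of s "\<lambda>i. \<bar>w i\<bar>"] by auto
    have "T \<noteq> {}" using less.prems(4) \<open>s > 0\<close> by auto
    then have "S' \<subset> S" using less.prems(3) unfolding S'_def by blast
    then have "card S' < card S" using less.prems(1) by (rule psubset_card_mono[rotated])
    then have IH: "N (restr w (S' - T')) \<le> \<kappa> / sqrt (real s) * (\<Sum>i\<in>S'. \<bar>w i\<bar>)"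
      using less.hyps fin sub' T' by blast
    have "restr w S' = (\<lambda>i. restr w T' i + restr w (S' - T') i)"
      using T'(1) by (auto simp: restr_def fun_eq_iff)
    then have "N (restr w S') \<le> N (restr w T') + N (restr w (S' - T'))" by (simp add: sub)
    also have "\<dots> \<le> \<kappa> / sqrt (real s) * (\<Sum>i\<in>T. \<bar>w i\<bar>) + \<kappa> / sqrt (real s) * (\<Sum>i\<in>S'. \<bar>w i\<bar>)"
      using block[OF T'(1)] T'(2) IH by (intro add_mono) auto
    finally show ?thesis unfolding split S'_def by (simp add: ring_distribs)
  qed
qed

section \<open>Euclidean norm, heads and tails\<close>

lemma norm2_eq_L2_set: "norm2 n x = L2_set x {..<n}"
  by (simp add: norm2_def L2_set_def)

lemma norm2_nonneg [simp]: "norm2 n x \<ge> 0"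
  by (simp add: norm2_eq_L2_set)

lemma norm2_add_le: "norm2 n (\<lambda>i. x i + y i) \<le> norm2 n x + norm2 n y"
  unfolding norm2_eq_L2_set by (rule L2_set_triangle_ineq)

lemma norm2_uminus: "norm2 n (\<lambda>i. - x i) = norm2 n x"
  by (simp add: norm2_def)

lemma norm2_diff_le: "norm2 n (\<lambda>i. x i - y i) \<le> norm2 n x + norm2 n y"
  using norm2_add_le[of n x "\<lambda>i. - y i"] by (simp add: norm2_uminus)

lemma norm2_cong: "(\<And>i. i < n \<Longrightarrow> x i = y i) \<Longrightarrow> norm2 n x = norm2 n y"
  by (simp add: norm2_def)

lemma norm2_restr: "T \<subseteq> {..<n} \<Longrightarrow> norm2 n (restr w T) = sqrt (\<Sum>i\<in>T. (w i)\<^sup>2)"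
  unfolding norm2_def restr_def
  by (intro arg_cong[of _ _ sqrt] sum.mono_neutral_cong_right) auto

text \<open>One head \<open>T\<close> must serve two seminorms at once, the norm itself with
  constant 1 and the norm of the image under \<open>A\<close> with constant 1 + \<alpha>; therefore
  \<open>N\<close> and \<kappa> are quantified after \<open>T\<close>.\<close>

lemma sparse_head_tail:
  assumes "s > 0"
  shows "\<exists>T\<subseteq>{..<n}. card T \<le> s \<and>
    (\<forall>N \<kappa>. \<kappa> \<ge> 0 \<longrightarrow> (\<forall>x y. N (\<lambda>i. x i + y i) \<le> N x + N y) \<longrightarrow>
      (\<forall>R. R \<subseteq> {..<n} \<longrightarrow> card R \<le> s \<longrightarrow> N (restr w R) \<le> \<kappa> * norm2 n (restr w R)) \<longrightarrow>
      N (restr w ({..<n} - T)) \<le> \<kappa> / sqrt (real s) * norm1 n w)"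
proof (cases "s \<le> n")
  case True
  then obtain T where T: "T \<subseteq> {..<n}" "card T = s" "\<forall>i\<in>T. \<forall>j\<in>{..<n} - T. \<bar>w j\<bar> \<le> \<bar>w i\<bar>"
    using top_subset_exists[of "{..<n}" s "\<lambda>i. \<bar>w i\<bar>"] by auto
  have "N (restr w ({..<n} - T)) \<le> \<kappa> / sqrt (real s) * norm1 n w"
    if \<kappa>: "\<kappa> \<ge> 0" and sub: "\<forall>x y. N (\<lambda>i. x i + y i) \<le> N x + N y"
      and bd: "\<forall>R. R \<subseteq> {..<n} \<longrightarrow> card R \<le> s \<longrightarrow> N (restr w R) \<le> \<kappa> * norm2 n (restr w R)" for N \<kappa>
    unfolding norm1_def
  proof (rule seminorm_tail_bound[where U = "{..<n}"])
    show "N (\<lambda>i. x i + y i) \<le> N x + N y" for x y using sub by blast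
    show "N (restr w R) \<le> \<kappa> * sqrt (\<Sum>i\<in>R. (w i)\<^sup>2)" if "R \<subseteq> {..<n}" "card R \<le> s" for R
      unfolding norm2_restr[OF that(1), symmetric] using bd that by blast
  qed (use T assms \<kappa> in auto)
  then show ?thesis using T by (intro exI[of _ T]) auto
next
  \<comment> \<open>With fewer than \<open>s\<close> coordinates the head is everything; the
    hypothesis at the empty set bounds \<open>N\<close> of the zero tail.\<close>
  case False
  have "N (restr w ({..<n} - {..<n})) \<le> \<kappa> / sqrt (real s) * norm1 n w"
    if "\<kappa> \<ge> 0" "\<forall>R. R \<subseteq> {..<n} \<longrightarrow> card R \<le> s \<longrightarrow> N (restr w R) \<le> \<kappa> * norm2 n (restr w R)" for N \<kappa>
  proof -
    have "N (restr w {}) \<le> \<kappa> * norm2 n (restr w {})"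
      using that(2)[rule_format, of "{}"] by simp
    also have "norm2 n (restr w {}) = 0" by (simp add: norm2_restr)
    also have "\<kappa> * 0 \<le> \<kappa> / sqrt (real s) * norm1 n w"
      using that(1) by (simp add: norm1_def sum_nonneg)
    finally show ?thesis by simp
  qed
  then show ?thesis using False by (intro exI[of _ "{..<n}"] conjI allI impI) auto
qed

lemma matvec_add: "matvec m n A (\<lambda>i. x i + y i) = (\<lambda>i. matvec m n A x i + matvec m n A y i)"
  by (auto simp: matvec_def algebra_simps sum.distrib)

lemma matvec_diff: "matvec m n A (\<lambda>i. x i - y i) = (\<lambda>i. matvec m n A x i - matvec m n A y i)"
  by (auto simp: matvec_def algebra_simps sum_subtractf)

lemma matvec_cong: "(\<And>i. i < n \<Longrightarrow> x i = y i) \<Longrightarrow> matvec m n A x = matvec m n A y"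
  by (auto simp: matvec_def)

text \<open>Square roots are avoided through (1 - \<alpha>)^2 \<le> 1 - \<alpha> and 1 + \<alpha>
  \<le> (1 + \<alpha>)^2.\<close>

lemma near_isometric_norm:
  assumes "near_isometric m n A \<alpha> u" "0 \<le> \<alpha>" "\<alpha> < 1"
  shows "(1 - \<alpha>) * norm2 n u \<le> norm2 m (matvec m n A u)"
    and "norm2 m (matvec m n A u) \<le> (1 + \<alpha>) * norm2 n u"
proof -
  have iso: "(1 - \<alpha>) * (norm2 n u)\<^sup>2 \<le> (norm2 m (matvec m n A u))\<^sup>2"
    "(norm2 m (matvec m n A u))\<^sup>2 \<le> (1 + \<alpha>) * (norm2 n u)\<^sup>2"
    using assms(1) unfolding near_isometric_def norm2_sq by (auto simp: abs_le_iff algebra_simps)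
  have "(1 - \<alpha>) * (1 - \<alpha>) \<le> (1 - \<alpha>) * 1" using assms by (intro mult_left_mono) auto
  then have "((1 - \<alpha>) * norm2 n u)\<^sup>2 \<le> (1 - \<alpha>) * (norm2 n u)\<^sup>2"
    unfolding power_mult_distrib by (intro mult_right_mono) (auto simp: power2_eq_square)
  with iso(1) show "(1 - \<alpha>) * norm2 n u \<le> norm2 m (matvec m n A u)"
    by (intro power2_le_imp_le[of "(1 - \<alpha>) * norm2 n u"]) auto
  have "(1 + \<alpha>) * 1 \<le> (1 + \<alpha>) * (1 + \<alpha>)" using assms by (intro mult_left_mono) auto
  then have "(1 + \<alpha>) * (norm2 n u)\<^sup>2 \<le> ((1 + \<alpha>) * norm2 n u)\<^sup>2"
    unfolding power_mult_distrib by (intro mult_right_mono) (auto simp: power2_eq_square)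
  with iso(2) have "(norm2 m (matvec m n A u))\<^sup>2 \<le> ((1 + \<alpha>) * norm2 n u)\<^sup>2" by linarith
  then show "norm2 m (matvec m n A u) \<le> (1 + \<alpha>) * norm2 n u"
    using assms by (intro power2_le_imp_le[OF _ mult_nonneg_nonneg]) auto
qed

text \<open>Split x - x' = u + v below \<open>n\<close>, with \<open>v\<close> the tail of the
  difference of approximation errors. Since \<open>A\<close> maps x - x' to a noise difference of
  norm at most 2 \<epsilon>max, the lower isometry bound at \<open>u\<close> costs that plus the
  image of \<open>v\<close>, and both \<open>v\<close> and its image are controlled by the l1
  errors.\<close>

lemma two_point_bound:
  assumes iso: "\<And>z z' w. vec_in k z \<Longrightarrow> vec_in k z' \<Longrightarrow> card {i. i < n \<and> w i \<noteq> 0} \<le> 4 * l \<Longrightarrow>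
                  near_isometric m n A \<alpha> (\<lambda>i. G z i - G z' i + w i)"
    and \<alpha>: "0 < \<alpha>" "\<alpha> < 1" and "l > 0"
    and \<epsilon>: "norm2 m \<epsilon> \<le> \<epsilon>max" "norm2 m \<epsilon>' \<le> \<epsilon>max"
    and eq: "\<And>j. matvec m n A x j + \<epsilon> j = matvec m n A x' j + \<epsilon>' j"
    and xh: "xh \<in> S_G k n l G" "xh' \<in> S_G k n l G"
  shows "norm2 n (\<lambda>i. x i - x' i) \<le> ((1 + \<alpha>) / (1 - \<alpha>) + 1) / sqrt (2 * real l) *
           (norm1 n (\<lambda>i. x i - xh i) + norm1 n (\<lambda>i. x' i - xh' i)) + 2 / (1 - \<alpha>) * \<epsilon>max"
proof -
  obtain z z' where z: "vec_in k z" "norm0 n (\<lambda>i. xh i - G z i) \<le> l"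
    and z': "vec_in k z'" "norm0 n (\<lambda>i. xh' i - G z' i) \<le> l"
    using xh by (auto simp: S_G_def S_s_def)
  define w where "w = (\<lambda>i. (x i - xh i) - (x' i - xh' i))"
  define B where "B = norm1 n w / sqrt (2 * real l)"
  obtain T where T: "T \<subseteq> {..<n}" "card T \<le> 2 * l"
    and tail: "\<And>N \<kappa>. \<kappa> \<ge> 0 \<Longrightarrow> \<forall>x y. N (\<lambda>i. x i + y i) \<le> N x + N y \<Longrightarrow>
      \<forall>R. R \<subseteq> {..<n} \<longrightarrow> card R \<le> 2 * l \<longrightarrow> N (restr w R) \<le> \<kappa> * norm2 n (restr w R) \<Longrightarrow>
      N (restr w ({..<n} - T)) \<le> \<kappa> / sqrt (real (2 * l)) * norm1 n w"
    using sparse_head_tail[of "2 * l" n w] \<open>l > 0\<close> by auto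
  have sparse: "near_isometric m n A \<alpha> (restr w R)" if "R \<subseteq> {..<n}" "card R \<le> 4 * l" for R
  proof -
    have "card {i. i < n \<and> restr w R i \<noteq> 0} \<le> card R"
      using finite_subset[OF that(1)] by (intro card_mono) (auto simp: restr_def)
    \<comment> \<open>With equal latent points the network terms cancel, so the hypothesis covers
      plain sparse vectors.\<close>
    then show ?thesis using iso[OF z(1) z(1), of "restr w R"] that(2) by simp
  qed
  define v where "v = restr w ({..<n} - T)"
  have v2: "norm2 n v \<le> B"
    using tail[of 1 "norm2 n"] by (simp add: norm2_add_le v_def B_def)
  have Av: "norm2 m (matvec m n A v) \<le> (1 + \<alpha>) * B"
  proof -
    have "norm2 m (matvec m n A v) \<le> (1 + \<alpha>) / sqrt (real (2 * l)) * norm1 n w"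
      unfolding v_def
    proof (rule tail[of "1 + \<alpha>" "\<lambda>u. norm2 m (matvec m n A u)"])
      show "\<forall>x y. norm2 m (matvec m n A (\<lambda>i. x i + y i)) \<le> norm2 m (matvec m n A x) + norm2 m (matvec m n A y)"
        by (simp add: matvec_add norm2_add_le)
      show "\<forall>R. R \<subseteq> {..<n} \<longrightarrow> card R \<le> 2 * l \<longrightarrow> norm2 m (matvec m n A (restr w R)) \<le> (1 + \<alpha>) * norm2 n (restr w R)"
        using near_isometric_norm(2)[OF sparse] \<alpha> by auto
    qed (use \<alpha> in simp)
    then show ?thesis by (simp add: B_def)
  qed
  \<comment> \<open>The network terms cancel algebraically, leaving xh - xh' plus the head of
    \<open>w\<close>; they are displayed to expose the required form, network difference plus sparse
    vector.\<close>
  define u where "u = (\<lambda>i. G z i - G z' i + ((xh i - G z i) - (xh' i - G z' i) + restr w T i))"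
  have uv: "x i - x' i = u i + v i" if "i < n" for i
    using that by (simp add: u_def v_def w_def restr_def)
  have "card {i. i < n \<and> (xh i - G z i) - (xh' i - G z' i) + restr w T i \<noteq> 0} \<le>
        card ({i. i < n \<and> xh i - G z i \<noteq> 0} \<union> {i. i < n \<and> xh' i - G z' i \<noteq> 0} \<union> T)"
    using finite_subset[OF T(1)] by (intro card_mono) (auto simp: restr_def)
  also have "\<dots> \<le> norm0 n (\<lambda>i. xh i - G z i) + norm0 n (\<lambda>i. xh' i - G z' i) + card T"
    unfolding norm0_def by (meson add_right_mono card_Un_le order_trans)
  also have "\<dots> \<le> 4 * l" using z(2) z'(2) T(2) by simp
  finally have "near_isometric m n A \<alpha> u"
    unfolding u_def by (rule iso[OF z(1) z'(1)])
  then have "(1 - \<alpha>) * norm2 n u \<le> norm2 m (matvec m n A u)"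
    using near_isometric_norm(1) \<alpha> by simp
  also have "matvec m n A u = matvec m n A (\<lambda>i. (x i - x' i) - v i)"
    by (rule matvec_cong) (simp add: uv)
  also have "norm2 m \<dots> \<le> norm2 m (matvec m n A (\<lambda>i. x i - x' i)) + norm2 m (matvec m n A v)"
    by (subst matvec_diff) (rule norm2_diff_le)
  also have "matvec m n A (\<lambda>i. x i - x' i) = (\<lambda>j. \<epsilon>' j - \<epsilon> j)"
  proof
    fix j
    show "matvec m n A (\<lambda>i. x i - x' i) j = \<epsilon>' j - \<epsilon> j" using eq[of j] by (simp add: matvec_diff)
  qed
  also have "norm2 m \<dots> \<le> 2 * \<epsilon>max" using norm2_diff_le[of m \<epsilon>' \<epsilon>] \<epsilon> by simp
  finally have "(1 - \<alpha>) * norm2 n u \<le> 2 * \<epsilon>max + (1 + \<alpha>) * B" using Av by simp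
  then have u2: "norm2 n u \<le> (2 * \<epsilon>max + (1 + \<alpha>) * B) / (1 - \<alpha>)"
    using \<alpha> by (simp add: pos_le_divide_eq mult.commute)
  have "norm2 n (\<lambda>i. x i - x' i) = norm2 n (\<lambda>i. u i + v i)" by (rule norm2_cong) (rule uv)
  also have "\<dots> \<le> norm2 n u + norm2 n v" by (rule norm2_add_le)
  also have "\<dots> \<le> (2 * \<epsilon>max + (1 + \<alpha>) * B) / (1 - \<alpha>) + B" using u2 v2 by simp
  also have "\<dots> = ((1 + \<alpha>) / (1 - \<alpha>) + 1) * B + 2 / (1 - \<alpha>) * \<epsilon>max"
    by (simp add: add_divide_distrib algebra_simps)
  also have "\<dots> \<le> ((1 + \<alpha>) / (1 - \<alpha>) + 1) *
      ((norm1 n (\<lambda>i. x i - xh i) + norm1 n (\<lambda>i. x' i - xh' i)) / sqrt (2 * real l)) + 2 / (1 - \<alpha>) * \<epsilon>max"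
  proof -
    have "norm1 n w \<le> norm1 n (\<lambda>i. x i - xh i) + norm1 n (\<lambda>i. x' i - xh' i)"
      unfolding norm1_def sum.distrib[symmetric] w_def by (intro sum_mono) linarith
    then have "B \<le> (norm1 n (\<lambda>i. x i - xh i) + norm1 n (\<lambda>i. x' i - xh' i)) / sqrt (2 * real l)"
      unfolding B_def by (intro divide_right_mono) auto
    then show ?thesis using \<alpha> by (intro add_right_mono mult_left_mono) auto
  qed
  finally show ?thesis by simp
qed

section \<open>Compactness and a centre for the feasible signals\<close>

lemma bounded_coordinates_convergent_subseq:
  fixes X :: "nat \<Rightarrow> nat \<Rightarrow> real"
  assumes "\<And>i. i < n \<Longrightarrow> Bseq (\<lambda>j. X j i)"
  shows "\<exists>r :: nat \<Rightarrow> nat. strict_mono r \<and> (\<forall>i<n. convergent (\<lambda>j. X (r j) i))"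
  using assms
proof (induction n)
  case 0
  show ?case by (intro exI[of _ id]) (auto simp: strict_mono_def)
next
  case (Suc n)
  then obtain r where r: "strict_mono r" "\<forall>i<n. convergent (\<lambda>j. X (r j) i)" by auto
  have "Bseq (\<lambda>j. X (r j) n)" using Suc.prems[of n] by (auto simp: Bseq_def)
  then have "bounded (range (\<lambda>j. X (r j) n))" by (simp add: Bseq_eq_bounded)
  then obtain L r' where r': "strict_mono r'" "((\<lambda>j. X (r j) n) \<circ> r') \<longlonglongrightarrow> L"
    using bounded_imp_convergent_subsequence by blast
  have "convergent (\<lambda>j. X (r (r' j)) i)" if "i < Suc n" for i
  proof (cases "i = n")
    case True
    then show ?thesis using r'(2) by (auto simp: comp_def convergent_def)
  next
    case False
    then have "convergent (\<lambda>j. X (r j) i)" using r(2) that by simp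
    then show ?thesis using convergent_subseq_convergent[OF _ r'(1)] by (auto simp: comp_def)
  qed
  then show ?case using strict_mono_o[OF r(1) r'(1)]
    by (intro exI[of _ "r \<circ> r'"]) (simp add: comp_def)
qed

lemma abs_le_norm2: "i < n \<Longrightarrow> \<bar>x i\<bar> \<le> norm2 n x"
  unfolding norm2_eq_L2_set
  using member_le_L2_set[of "{..<n}" i "\<lambda>i. \<bar>x i\<bar>"] by (simp add: L2_set_def)

text \<open>The centre is a limit of a minimising sequence of \<open>\<sigma>\<close>, so that no minimiser need exist.\<close>
lemma minimizing_center_exists:
  assumes "X \<noteq> {}" and \<sigma>: "\<And>x. x \<in> X \<Longrightarrow> 0 \<le> \<sigma> x" and "K \<ge> 0"
    and two: "\<And>x y. x \<in> X \<Longrightarrow> y \<in> X \<Longrightarrow> norm2 n (\<lambda>i. x i - y i) \<le> K * (\<sigma> x + \<sigma> y) + B"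
  shows "\<exists>c. \<forall>x\<in>X. norm2 n (\<lambda>i. x i - c i) \<le> K * (2 * \<sigma> x) + B"
proof -
  define I where "I = (INF x\<in>X. \<sigma> x)"
  have bdd: "bdd_below (\<sigma> ` X)" using \<sigma> by (intro bdd_belowI[of _ 0]) auto
  have I: "I \<le> \<sigma> x" if "x \<in> X" for x unfolding I_def by (rule cINF_lower[OF bdd that])
  have "\<exists>x\<in>X. \<sigma> x < I + 1 / real (Suc j)" for j
    using cINF_less_iff[OF \<open>X \<noteq> {}\<close> bdd, of "I + 1 / real (Suc j)"] by (simp add: I_def)
  then obtain x where x: "\<And>j. x j \<in> X" "\<And>j. \<sigma> (x j) < I + 1 / real (Suc j)" by metis
  have "Bseq (\<lambda>j. x j i)" if "i < n" for i
  proof (rule BseqI')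
    fix j
    have "1 / real (Suc j) \<le> 1" by simp
    then have "\<sigma> (x j) \<le> I + 1" using x(2)[of j] by linarith
    have "\<bar>x j i - x 0 i\<bar> \<le> norm2 n (\<lambda>i. x j i - x 0 i)"
      using abs_le_norm2[OF that, of "\<lambda>i. x j i - x 0 i"] .
    also have "\<dots> \<le> K * (\<sigma> (x j) + \<sigma> (x 0)) + B" by (rule two[OF x(1) x(1)])
    also have "\<dots> \<le> K * (I + 1 + \<sigma> (x 0)) + B"
      using \<open>\<sigma> (x j) \<le> I + 1\<close> \<open>K \<ge> 0\<close> by (intro add_right_mono mult_left_mono) auto
    finally show "norm (x j i) \<le> K * (I + 1 + \<sigma> (x 0)) + B + \<bar>x 0 i\<bar>" by simp
  qed
  then obtain r where r: "strict_mono r" "\<forall>i<n. convergent (\<lambda>j. x (r j) i)"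
    using bounded_coordinates_convergent_subseq by blast
  define c where "c = (\<lambda>i. lim (\<lambda>j. x (r j) i))"
  have c: "(\<lambda>j. x (r j) i) \<longlonglongrightarrow> c i" if "i < n" for i
    using r(2) that unfolding c_def by (simp add: convergent_LIMSEQ_iff)
  have "norm2 n (\<lambda>i. y i - c i) \<le> K * (2 * \<sigma> y) + B" if "y \<in> X" for y
  proof -
    have "(\<lambda>j. norm2 n (\<lambda>i. y i - x (r j) i)) \<longlonglongrightarrow> norm2 n (\<lambda>i. y i - c i)"
      unfolding norm2_def using c by (intro tendsto_intros) auto
    moreover have "(\<lambda>j. K * (\<sigma> y + (I + 1 / real (Suc (r j)))) + B) \<longlonglongrightarrow> K * (\<sigma> y + (I + 0)) + B"
      using LIMSEQ_subseq_LIMSEQ[OF LIMSEQ_inverse_real_of_nat r(1)]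
      by (intro tendsto_intros) (simp add: comp_def inverse_eq_divide)
    moreover have "norm2 n (\<lambda>i. y i - x (r j) i) \<le> K * (\<sigma> y + (I + 1 / real (Suc (r j)))) + B" for j
    proof -
      have "norm2 n (\<lambda>i. y i - x (r j) i) \<le> K * (\<sigma> y + \<sigma> (x (r j))) + B" by (rule two[OF that x(1)])
      also have "\<dots> \<le> K * (\<sigma> y + (I + 1 / real (Suc (r j)))) + B"
        using x(2)[of "r j"] \<open>K \<ge> 0\<close> by (intro add_right_mono mult_left_mono) auto
      finally show ?thesis .
    qed
    ultimately have "norm2 n (\<lambda>i. y i - c i) \<le> K * (\<sigma> y + (I + 0)) + B"
      by (intro LIMSEQ_le) auto
    \<comment> \<open>The infimum \<open>I\<close> is at most \<open>\<sigma> y\<close>; replacing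
      it by \<open>\<sigma> y\<close> produces the leading factor 2 of C0.\<close>
    also have "\<dots> \<le> K * (2 * \<sigma> y) + B"
      using I[OF that] \<open>K \<ge> 0\<close> by (intro add_right_mono mult_left_mono) auto
    finally show ?thesis .
  qed
  then show ?thesis by blast
qed

text \<open>Takes the two-point bound to the infimum over one approximant while the other stays
  fixed in \<open>b\<close>; applied twice it yields both \<sigma> terms without any
  minimiser.\<close>

lemma le_affine_INF:
  fixes f :: "'a \<Rightarrow> real"
  assumes "K > 0" "P \<noteq> {}" and le: "\<And>p. p \<in> P \<Longrightarrow> d \<le> K * (f p + b) + B"
  shows "d \<le> K * ((INF p\<in>P. f p) + b) + B"
proof -
  have "(d - B) / K - b \<le> (INF p\<in>P. f p)"
    using assms by (intro cINF_greatest) (auto simp: field_simps)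
  then show ?thesis using \<open>K > 0\<close> by (simp add: field_simps)
qed

lemma decoder_exists:
  assumes iso: "\<And>z z' w. vec_in k z \<Longrightarrow> vec_in k z' \<Longrightarrow> card {i. i < n \<and> w i \<noteq> 0} \<le> 4 * l \<Longrightarrow>
                  near_isometric m n A \<alpha> (\<lambda>i. G z i - G z' i + w i)"
    and \<alpha>: "0 < \<alpha>" "\<alpha> < 1" and "l > 0" and "\<And>z. vec_in n (G z)"
  shows "\<exists>\<Delta> :: (nat \<Rightarrow> real) \<Rightarrow> (nat \<Rightarrow> real).
          \<forall>x \<epsilon>. vec_in n x \<and> vec_in m \<epsilon> \<and> norm2 m \<epsilon> \<le> \<epsilon>max \<longrightarrow>
            norm2 n (\<lambda>i. x i - \<Delta> (\<lambda>j. matvec m n A x j + \<epsilon> j) i)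
              \<le> (2 * real l) powr (-1/2) * (2 * ((1 + \<alpha>) / (1 - \<alpha>) + 1)) * sigma_G k n l G x
                 + 2 / (1 - \<alpha>) * \<epsilon>max"
proof -
  define K where "K = ((1 + \<alpha>) / (1 - \<alpha>) + 1) / sqrt (2 * real l)"
  define B where "B = 2 / (1 - \<alpha>) * \<epsilon>max"
  have "(1 + \<alpha>) / (1 - \<alpha>) + 1 > 0" using \<alpha> by (intro add_pos_pos divide_pos_pos) auto
  then have K: "K > 0" using \<open>l > 0\<close> by (simp add: K_def)
  \<comment> \<open>All signals compatible with the measurement \<open>y\<close>. The decoder sees
    only \<open>y\<close>, so a single centre has to serve the whole set.\<close>
  define F where "F = (\<lambda>y. {x. vec_in n x \<and> (\<exists>\<epsilon>. vec_in m \<epsilon> \<and> norm2 m \<epsilon> \<le> \<epsilon>max \<and>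
      y = (\<lambda>j. matvec m n A x j + \<epsilon> j))})"
  \<comment> \<open>Nonemptiness makes the infimum in \<open>sigma_G\<close> a genuine one; the
    value of \<open>G\<close> belongs to its own sparse neighbourhood because it vanishes beyond
    \<open>n\<close>.\<close>
  have "G (\<lambda>_. 0) \<in> S_G k n l G"
    using assms(5) by (auto simp: S_G_def S_s_def norm0_def vec_in_def intro!: exI[of _ "\<lambda>_. 0"])
  then have ne: "S_G k n l G \<noteq> {}" by auto
  have \<sigma>0: "0 \<le> sigma_G k n l G x" for x
    unfolding sigma_G_def using ne by (intro cINF_greatest) (auto simp: norm1_def sum_nonneg)
  have two: "norm2 n (\<lambda>i. x i - x' i) \<le> K * (sigma_G k n l G x + sigma_G k n l G x') + B"
    if "x \<in> F y" "x' \<in> F y" for x x' y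
  proof -
    obtain \<epsilon> where \<epsilon>: "norm2 m \<epsilon> \<le> \<epsilon>max" "y = (\<lambda>j. matvec m n A x j + \<epsilon> j)"
      using \<open>x \<in> F y\<close> by (auto simp: F_def)
    obtain \<epsilon>' where \<epsilon>': "norm2 m \<epsilon>' \<le> \<epsilon>max" "y = (\<lambda>j. matvec m n A x' j + \<epsilon>' j)"
      using \<open>x' \<in> F y\<close> by (auto simp: F_def)
    have eq: "matvec m n A x j + \<epsilon> j = matvec m n A x' j + \<epsilon>' j" for j
      using fun_cong[OF \<epsilon>(2), of j] fun_cong[OF \<epsilon>'(2), of j] by simp
    have p: "norm2 n (\<lambda>i. x i - x' i) \<le> K * (norm1 n (\<lambda>i. x i - xh i) + norm1 n (\<lambda>i. x' i - xh' i)) + B"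
      if "xh \<in> S_G k n l G" "xh' \<in> S_G k n l G" for xh xh'
      unfolding K_def B_def by (rule two_point_bound[OF iso \<alpha> \<open>l > 0\<close> \<epsilon>(1) \<epsilon>'(1) eq that])
    have q: "norm2 n (\<lambda>i. x i - x' i) \<le> K * (norm1 n (\<lambda>i. x' i - xh' i) + sigma_G k n l G x) + B"
      if "xh' \<in> S_G k n l G" for xh'
      using le_affine_INF[OF K ne p[OF _ that]] unfolding sigma_G_def by (simp add: add.commute)
    have "norm2 n (\<lambda>i. x i - x' i) \<le> K * (sigma_G k n l G x' + sigma_G k n l G x) + B"
      unfolding sigma_G_def[of k n l G x'] by (rule le_affine_INF[OF K ne q])
    then show ?thesis by (simp add: add.commute)
  qed
  have "\<exists>c. \<forall>x\<in>F y. norm2 n (\<lambda>i. x i - c i) \<le> K * (2 * sigma_G k n l G x) + B" for y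
  proof (cases "F y = {}")
    case False
    then show ?thesis
      using \<sigma>0 K two by (intro minimizing_center_exists) auto
  qed auto
  then obtain \<Delta> where \<Delta>: "\<And>y x. x \<in> F y \<Longrightarrow> norm2 n (\<lambda>i. x i - \<Delta> y i) \<le> K * (2 * sigma_G k n l G x) + B"
    by metis
  have "(2 * real l) powr (-1/2) = 1 / sqrt (2 * real l)"
    using \<open>l > 0\<close> by (simp add: powr_minus powr_half_sqrt inverse_eq_divide)
  then have K': "(2 * real l) powr (-1/2) * (2 * ((1 + \<alpha>) / (1 - \<alpha>) + 1)) * s = K * (2 * s)" for s
    by (simp add: K_def)
  show ?thesis
    unfolding K' B_def[symmetric]
    by (intro exI[of _ \<Delta>] allI impI \<Delta>) (auto simp: F_def)
qed

section \<open>Union over the pieces\<close>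

lemma near_isometric_cong:
  "(\<And>i. i < n \<Longrightarrow> x i = y i) \<Longrightarrow> near_isometric m n A \<tau> x = near_isometric m n A \<tau> y"
  using matvec_cong[of n x y m A] by (simp add: near_isometric_def dot_def)

text \<open>\<open>V\<close> need not be a subspace and the generators may be dependent: only
  containment in a span of \<open>D\<close> vectors is recorded, up to coordinates below
  \<open>n\<close>.\<close>

definition spanned :: "nat \<Rightarrow> nat \<Rightarrow> (nat \<Rightarrow> real) set \<Rightarrow> bool" where
  "spanned n D V \<longleftrightarrow> (\<exists>v. \<forall>u\<in>V. \<exists>c. \<forall>i<n. u i = lincomb D v c i)"

lemma sum_lessThan_add:
  fixes f :: "nat \<Rightarrow> 'a::comm_monoid_add"
  shows "(\<Sum>j<a + b. f j) = (\<Sum>j<a. f j) + (\<Sum>j<b. f (a + j))"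
  by (induction b) (auto simp: add_ac)

lemma spanned_add:
  assumes "spanned n D1 V1" "spanned n D2 V2"
    and V: "\<And>u. u \<in> V \<Longrightarrow> \<exists>x\<in>V1. \<exists>y\<in>V2. \<forall>i<n. u i = x i + y i"
  shows "spanned n (D1 + D2) V"
proof -
  obtain v1 where v1: "\<And>u. u \<in> V1 \<Longrightarrow> \<exists>c. \<forall>i<n. u i = lincomb D1 v1 c i"
    using assms(1) unfolding spanned_def by blast
  obtain v2 where v2: "\<And>u. u \<in> V2 \<Longrightarrow> \<exists>c. \<forall>i<n. u i = lincomb D2 v2 c i"
    using assms(2) unfolding spanned_def by blast
  define v where "v = (\<lambda>j. if j < D1 then v1 j else v2 (j - D1))"
  have "\<exists>c. \<forall>i<n. u i = lincomb (D1 + D2) v c i" if "u \<in> V" for u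
  proof -
    obtain x y where xy: "x \<in> V1" "y \<in> V2" "\<forall>i<n. u i = x i + y i" using V[OF \<open>u \<in> V\<close>] by blast
    obtain c1 where c1: "\<forall>i<n. x i = lincomb D1 v1 c1 i" using v1[OF xy(1)] by blast
    obtain c2 where c2: "\<forall>i<n. y i = lincomb D2 v2 c2 i" using v2[OF xy(2)] by blast
    have "lincomb (D1 + D2) v (\<lambda>j. if j < D1 then c1 j else c2 (j - D1)) i
        = lincomb D1 v1 c1 i + lincomb D2 v2 c2 i" for i
      unfolding lincomb_def sum_lessThan_add
      by (intro arg_cong2[of _ _ _ _ "(+)"] sum.cong) (auto simp: v_def)
    then show ?thesis using xy(3) c1 c2
      by (intro exI[of _ "\<lambda>j. if j < D1 then c1 j else c2 (j - D1)"]) simp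
  qed
  then show ?thesis unfolding spanned_def by blast
qed

lemma spanned_linear_image: "spanned n k (range (\<lambda>z i. \<Sum>j<k. M i j * z j))"
proof -
  have "\<forall>i<n. (\<Sum>j<k. M i j * z j) = lincomb k (\<lambda>j i. M i j) z i" for z
    by (simp add: lincomb_def mult.commute)
  then show ?thesis unfolding spanned_def by blast
qed

lemma spanned_support:
  assumes T: "T \<subseteq> {..<n}"
  shows "spanned n (card T) {w. \<forall>i<n. w i \<noteq> 0 \<longrightarrow> i \<in> T}"
proof -
  have fin: "finite T" using T finite_subset by blast
  then obtain h where "bij_betw h {0..<card T} T" using ex_bij_betw_nat_finite by blast
  then have h: "bij_betw h {..<card T} T" by (simp add: lessThan_atLeast0)
  have "w i = lincomb (card T) (\<lambda>j i. of_bool (i = h j)) (\<lambda>j. w (h j)) i"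
    if w: "\<forall>i<n. w i \<noteq> 0 \<longrightarrow> i \<in> T" and "i < n" for w i
  proof -
    have "lincomb (card T) (\<lambda>j i. of_bool (i = h j)) (\<lambda>j. w (h j)) i
        = (\<Sum>j<card T. (\<lambda>t. w t * of_bool (i = t)) (h j))" by (simp add: lincomb_def)
    also have "\<dots> = (\<Sum>t\<in>T. w t * of_bool (i = t))" by (rule sum.reindex_bij_betw[OF h])
    also have "\<dots> = (\<Sum>t\<in>T. if i = t then w t else 0)" by (intro sum.cong) auto
    also have "\<dots> = w i" using fin w \<open>i < n\<close> by auto
    finally show ?thesis by simp
  qed
  then show ?thesis unfolding spanned_def by blast
qed

text \<open>The net is chosen before \<open>m\<close>, \<open>A\<close> and \<tau>, so its points
  are deterministic and a union bound over them is legitimate.\<close>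

lemma spanned_net:
  assumes "spanned n D V"
  shows "\<exists>F. finite F \<and> real (card F) \<le> 48 ^ D \<and>
    (\<forall>m A \<tau>. \<tau> \<ge> 0 \<longrightarrow> (\<forall>f\<in>F. near_isometric m n A \<tau> f) \<longrightarrow> (\<forall>u\<in>V. near_isometric m n A (5 * \<tau>) u))"
proof -
  obtain v where v: "\<And>u. u \<in> V \<Longrightarrow> \<exists>c. \<forall>i<n. u i = lincomb D v c i"
    using assms unfolding spanned_def by blast
  obtain D' e where D': "D' \<le> D" "orthonormal n D' e"
    and e: "\<And>c. \<exists>c'. \<forall>i<n. lincomb D v c i = lincomb D' e c' i"
    using gram_schmidt by blast
  define F where "F = (\<lambda>a. lincomb D' e (\<lambda>j. real_of_int (a j))) ` int_net D'"
  have fin: "finite F" by (simp add: F_def finite_int_net)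
  have "real (card F) \<le> real (card (int_net D'))"
    unfolding F_def by (intro of_nat_mono card_image_le finite_int_net)
  also have "\<dots> \<le> 48 ^ D'" by (rule card_int_net)
  also have "\<dots> \<le> 48 ^ D" using D'(1) by (intro power_increasing) auto
  finally have card: "real (card F) \<le> 48 ^ D" .
  have "near_isometric m n A (5 * \<tau>) u"
    if "\<tau> \<ge> 0" "\<forall>f\<in>F. near_isometric m n A \<tau> f" "u \<in> V" for m A \<tau> u
  proof -
    obtain c where c: "\<forall>i<n. u i = lincomb D v c i" using v[OF \<open>u \<in> V\<close>] by blast
    obtain c' where c': "\<forall>i<n. lincomb D v c i = lincomb D' e c' i" using e by blast
    have "near_isometric m n A (5 * \<tau>) (lincomb D' e c')"
      using that(2) by (intro near_isometric_span[OF D'(2) that(1)]) (auto simp: F_def)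
    moreover have "near_isometric m n A (5 * \<tau>) u = near_isometric m n A (5 * \<tau>) (lincomb D' e c')"
      using c c' by (intro near_isometric_cong) simp
    ultimately show ?thesis by simp
  qed
  then show ?thesis using fin card by blast
qed

text \<open>The latent vectors are unrestricted, so the set depends on the two affine maps alone and
  forgets the cells on which the network agrees with them.\<close>

definition piece_diffs :: "nat \<Rightarrow> nat \<Rightarrow> (nat \<Rightarrow> nat \<Rightarrow> real) \<times> (nat \<Rightarrow> real) \<Rightarrow>
    (nat \<Rightarrow> nat \<Rightarrow> real) \<times> (nat \<Rightarrow> real) \<Rightarrow> nat set \<Rightarrow> (nat \<Rightarrow> real) set" where
  "piece_diffs n k p q T = {\<lambda>i. affine_map k p z i - affine_map k q z' i + w i | z z' w.
      \<forall>i<n. w i \<noteq> 0 \<longrightarrow> i \<in> T}"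

text \<open>The two linear parts need \<open>k\<close> generators each, the difference of the
  offsets is one fixed vector, and the sparse term needs one generator per element of
  \<open>T\<close>.\<close>

lemma spanned_piece_diffs:
  assumes "T \<subseteq> {..<n}"
  shows "spanned n (2 * k + 1 + card T) (piece_diffs n k p q T)"
proof -
  define L where "L = (\<lambda>M :: nat \<Rightarrow> nat \<Rightarrow> real. range (\<lambda>z i. \<Sum>j<k. M i j * z j))"
  \<comment> \<open>The line through the offset difference, written as a linear image of a
    one-dimensional space so that the rule for linear images covers it.\<close>
  define B where "B = range (\<lambda>(t :: nat \<Rightarrow> real) i. \<Sum>j<1. (snd p i - snd q i) * t j)"
  define S where "S = {w :: nat \<Rightarrow> real. \<forall>i<n. w i \<noteq> 0 \<longrightarrow> i \<in> T}"
  have "spanned n (k + k) {\<lambda>i. x i + y i | x y. x \<in> L (fst p) \<and> y \<in> L (fst q)}"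
    by (rule spanned_add[of n k "L (fst p)" k "L (fst q)"]) (auto simp: L_def spanned_linear_image)
  then have "spanned n (k + k + 1)
      {\<lambda>i. (x i + y i) + b i | x y b. x \<in> L (fst p) \<and> y \<in> L (fst q) \<and> b \<in> B}"
    by (rule spanned_add[of n "k + k" _ 1 B]) (auto simp: B_def spanned_linear_image simp del: sum.lessThan_Suc; blast)+
  then have "spanned n (k + k + 1 + card T) (piece_diffs n k p q T)"
  proof (rule spanned_add[OF _ spanned_support[OF assms]])
    fix u assume "u \<in> piece_diffs n k p q T"
    then obtain z z' w where u: "u = (\<lambda>i. affine_map k p z i - affine_map k q z' i + w i)"
      and w: "w \<in> S" by (auto simp: piece_diffs_def S_def)
    define x where "x = (\<lambda>i. \<Sum>j<k. fst p i j * z j)"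
    define y where "y = (\<lambda>i. \<Sum>j<k. fst q i j * (- z' j))"
    define b where "b = (\<lambda>i. \<Sum>j<1::nat. (snd p i - snd q i) * (1::real))"
    have "x \<in> L (fst p)" unfolding L_def x_def by blast
    moreover have "y \<in> L (fst q)"
      unfolding L_def y_def by (rule range_eqI[of _ _ "\<lambda>j. - z' j"]) (rule refl)
    moreover have "b \<in> B" unfolding B_def b_def by (rule range_eqI[of _ _ "\<lambda>_. 1"]) simp
    moreover have "u i = (x i + y i + b i) + w i" for i
      by (simp add: u affine_map_def x_def y_def b_def sum_negf)
    ultimately show "\<exists>x\<in>{\<lambda>i. (x i + y i) + b i | x y b. x \<in> L (fst p) \<and> y \<in> L (fst q) \<and> b \<in> B}.
        \<exists>y\<in>{w. \<forall>i<n. w i \<noteq> 0 \<longrightarrow> i \<in> T}. \<forall>i<n. u i = x i + y i"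
      using w unfolding S_def
      by (intro bexI[of _ "\<lambda>i. (x i + y i) + b i"] bexI[of _ w] CollectI exI[of _ x] exI[of _ y] exI[of _ b])
         simp_all
  qed
  then show ?thesis by (simp add: mult_2)
qed

text \<open>Any smaller support extends to one of size exactly \<open>s\<close>, so only those are
  enumerated. The minimum handles r > n, where no support of size \<open>r\<close> exists.\<close>

lemma pieces_net:
  assumes "finite P" and s: "s = min r n"
  shows "\<exists>F. finite F \<and> real (card F) \<le> (real (card P))\<^sup>2 * real (n choose s) * 48 ^ (2 * k + 1 + s) \<and>
    (\<forall>m A \<tau> p q z z' w. \<tau> \<ge> 0 \<longrightarrow> (\<forall>f\<in>F. near_isometric m n A \<tau> f) \<longrightarrow> p \<in> P \<longrightarrow> q \<in> P \<longrightarrow>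
       card {i. i < n \<and> w i \<noteq> 0} \<le> r \<longrightarrow>
       near_isometric m n A (5 * \<tau>) (\<lambda>i. affine_map k p z i - affine_map k q z' i + w i))"
proof -
  define Ts where "Ts = {T. T \<subseteq> {..<n} \<and> card T = s}"
  have Ts: "finite Ts" "card Ts = n choose s"
    by (auto simp: Ts_def n_subsets)
  define R where "R = (\<lambda>p q T F. finite F \<and> real (card F) \<le> 48 ^ (2 * k + 1 + s) \<and>
    (\<forall>m A \<tau>. \<tau> \<ge> 0 \<longrightarrow> (\<forall>f\<in>F. near_isometric m n A \<tau> f) \<longrightarrow>
      (\<forall>u\<in>piece_diffs n k p q T. near_isometric m n A (5 * \<tau>) u)))"
  define F where "F = (\<lambda>p q T. SOME F. R p q T F)"
  have "R p q T (F p q T)" if "T \<in> Ts" for p q T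
    unfolding F_def
  proof (rule someI_ex)
    from that have "T \<subseteq> {..<n}" "card T = s" by (auto simp: Ts_def)
    then show "\<exists>F. R p q T F"
      using spanned_net[OF spanned_piece_diffs[of T n k p q]] by (simp add: R_def)
  qed
  then have F: "\<And>p q T. T \<in> Ts \<Longrightarrow> finite (F p q T)"
    "\<And>p q T. T \<in> Ts \<Longrightarrow> real (card (F p q T)) \<le> 48 ^ (2 * k + 1 + s)"
    "\<And>p q T m A \<tau> u. T \<in> Ts \<Longrightarrow> \<tau> \<ge> 0 \<Longrightarrow> \<forall>f\<in>F p q T. near_isometric m n A \<tau> f \<Longrightarrow>
      u \<in> piece_diffs n k p q T \<Longrightarrow> near_isometric m n A (5 * \<tau>) u"
    unfolding R_def by blast+
  define F' where "F' = (\<lambda>(p, q, T). F p q T)"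
  define U where "U = (\<Union>x\<in>P \<times> P \<times> Ts. F' x)"
  have fin: "finite (P \<times> P \<times> Ts)" using assms(1) Ts(1) by auto
  have "real (card U) \<le> real (\<Sum>x\<in>P \<times> P \<times> Ts. card (F' x))"
    unfolding U_def by (intro of_nat_mono card_UN_le fin)
  also have "\<dots> = (\<Sum>x\<in>P \<times> P \<times> Ts. real (card (F' x)))" by simp
  also have "\<dots> \<le> (\<Sum>x\<in>P \<times> P \<times> Ts. 48 ^ (2 * k + 1 + s))"
    using F(2) by (intro sum_mono) (auto simp: F'_def)
  also have "\<dots> = (real (card P))\<^sup>2 * real (n choose s) * 48 ^ (2 * k + 1 + s)"
    by (simp add: card_cartesian_product Ts(2) power2_eq_square mult_ac)
  finally have card: "real (card U) \<le> (real (card P))\<^sup>2 * real (n choose s) * 48 ^ (2 * k + 1 + s)" .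
  have fU: "finite U" unfolding U_def using fin F(1) by (intro finite_UN_I) (auto simp: F'_def)
  have iso: "near_isometric m n A (5 * \<tau>) (\<lambda>i. affine_map k p z i - affine_map k q z' i + w i)"
    if "\<tau> \<ge> 0" and net: "\<forall>f\<in>U. near_isometric m n A \<tau> f" and "p \<in> P" "q \<in> P"
      and w: "card {i. i < n \<and> w i \<noteq> 0} \<le> r" for m A \<tau> p q z z' w
  proof -
    have "card {i. i < n \<and> w i \<noteq> 0} \<le> card {..<n}" by (rule card_mono) auto
    then have "card {i. i < n \<and> w i \<noteq> 0} \<le> s" using w s by simp
    then obtain T where T: "{i. i < n \<and> w i \<noteq> 0} \<subseteq> T" "T \<subseteq> {..<n}" "card T = s"
      using exists_subset_between[of "{i. i < n \<and> w i \<noteq> 0}" s "{..<n}"] s by auto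
    then have "T \<in> Ts" by (simp add: Ts_def)
    moreover have "\<forall>f\<in>F p q T. near_isometric m n A \<tau> f"
      using net that(3,4) \<open>T \<in> Ts\<close> unfolding U_def F'_def by fastforce
    moreover have "(\<lambda>i. affine_map k p z i - affine_map k q z' i + w i) \<in> piece_diffs n k p q T"
      using T(1) unfolding piece_diffs_def by blast
    ultimately show ?thesis using F(3) \<open>\<tau> \<ge> 0\<close> by blast
  qed
  show ?thesis
    by (rule exI[of _ U], intro conjI allI impI) (fact card fU iso)+
qed

text \<open>A single term of (1 + x)^n at x = s / n gives the classical bound (e n / s)^s; then l
  \<le> s enlarges the base and s \<le> r the exponent.\<close>

lemma binomial_le_exp:
  assumes "0 < l" "l \<le> n" "l \<le> r" and s: "s = min r n"
  shows "real (n choose s) \<le> exp (real r * (1 + ln (real n / real l)))"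
proof -
  have "0 < s" "s \<le> n" "l \<le> s" "s \<le> r" using assms by auto
  define x where "x = real s / real n"
  have x: "x > 0" using \<open>0 < s\<close> \<open>s \<le> n\<close> by (simp add: x_def)
  have "real (n choose s) * x ^ s \<le> (\<Sum>k\<le>n. real (n choose k) * x ^ k)"
    using x \<open>s \<le> n\<close> by (intro member_le_sum) auto
  also have "\<dots> = (x + 1) ^ n" by (subst binomial_ring) simp
  also have "\<dots> = (1 + real s / real n) ^ n" by (simp add: x_def add.commute)
  also have "\<dots> \<le> exp (real s)"
    using \<open>0 < s\<close> \<open>s \<le> n\<close> by (intro exp_ge_one_plus_x_over_n_power_n) auto
  also have "\<dots> \<le> exp (real r)" using \<open>s \<le> r\<close> by simp
  finally have "real (n choose s) \<le> exp (real r) * (real n / real s) ^ s"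
    using x \<open>0 < s\<close> \<open>s \<le> n\<close> by (simp add: x_def field_simps power_divide)
  also have "(real n / real s) ^ s \<le> (real n / real l) ^ s"
    using \<open>l \<le> s\<close> \<open>0 < l\<close> by (intro power_mono divide_left_mono) auto
  also have "(real n / real l) ^ s \<le> (real n / real l) ^ r"
    using \<open>s \<le> r\<close> \<open>0 < l\<close> \<open>l \<le> n\<close> by (intro power_increasing) auto
  also have "(real n / real l) ^ r = exp (real r * ln (real n / real l))"
    using \<open>0 < l\<close> \<open>l \<le> n\<close> by (simp add: exp_of_nat_mult)
  also have "exp (real r) * \<dots> = exp (real r * (1 + ln (real n / real l)))"
    by (simp add: distrib_left flip: exp_add)
  finally show ?thesis by simp
qed

text \<open>The logarithm of the net size contains terms of order k + l without a logarithmic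
  factor. They are absorbed because d ln c0 \<ge> ln 2 \<ge> 1/2.\<close>

lemma net_size_bound:
  fixes k l d c0 n s N :: nat
  assumes "c0 \<ge> 2" "0 < l" "l \<le> n" "d \<ge> 1" and s: "s = min (4 * l) n"
    and N: "N \<le> (c0 + 1) ^ (k * (d - 1))"
  shows "2 * ((real N)\<^sup>2 * real (n choose s) * 48 ^ (2 * k + 1 + s))
    \<le> exp (100 * (real (k + l) * real d * ln (real c0) + real (k + l) * ln (real n / real l)))"
proof -
  define a where "a = real (k + l)"
  define Lc where "Lc = real d * ln (real c0)"
  define Ln where "Ln = ln (real n / real l)"
  have exp1: "2 \<le> exp (1::real)" using exp_ge_add_one_self[of 1] by simp
  have "ln 2 \<ge> (1/2::real)"
    using ln_one_minus_pos_upper_bound[of "1/2::real"] by (simp add: ln_div)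
  moreover have "ln 2 \<le> ln (real c0)" using assms(1) by simp
  ultimately have lc: "ln (real c0) \<ge> 1/2" by linarith
  have "1 * (1/2) \<le> Lc" unfolding Lc_def using lc assms(4) by (intro mult_mono) auto
  then have Lc: "Lc \<ge> 1/2" by simp
  have Ln: "Ln \<ge> 0" using assms(2,3) by (simp add: Ln_def)
  have a: "real k \<le> a" "real l \<le> a" "1 \<le> a" "0 \<le> a" using assms(2) by (auto simp: a_def)
  have "c0 + 1 \<le> c0\<^sup>2"
  proof -
    have "2 * c0 \<le> c0 * c0" using assms(1) by (intro mult_right_mono) auto
    then show ?thesis using assms(1) unfolding power2_eq_square by linarith
  qed
  \<comment> \<open>Passing from c0 + 1 to c0^2, which c0 \<ge> 2 permits, brings the count into
    powers of c0.\<close>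
  then have "(c0 + 1) ^ (k * (d - 1)) \<le> (c0\<^sup>2) ^ (k * (d - 1))" by (intro power_mono) auto
  also have "\<dots> \<le> (c0\<^sup>2) ^ (k * d)" using assms(1) by (intro power_increasing) auto
  finally have "N \<le> (c0\<^sup>2) ^ (k * d)" using N by linarith
  then have "real N \<le> real ((c0\<^sup>2) ^ (k * d))" by (rule of_nat_mono)
  also have "\<dots> = real c0 ^ (2 * (k * d))" by (simp add: power_mult)
  also have "\<dots> = exp (real (2 * (k * d)) * ln (real c0))" using assms(1) by (simp add: exp_of_nat_mult del: of_nat_mult)
  also have "\<dots> = exp (2 * real k * Lc)" by (simp add: Lc_def mult_ac)
  also have "\<dots> \<le> exp (2 * (a * Lc))"
    using a Lc by (simp add: mult.assoc mult_right_mono)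
  finally have "(real N)\<^sup>2 \<le> (exp (2 * (a * Lc)))\<^sup>2" by (intro power_mono) auto
  then have 1: "(real N)\<^sup>2 \<le> exp (4 * (a * Lc))" by (simp flip: exp_of_nat_mult)
  have "real (n choose s) \<le> exp (real (4 * l) * (1 + Ln))"
    unfolding Ln_def using assms by (intro binomial_le_exp) auto
  also have "\<dots> \<le> exp (4 * a + 4 * (a * Ln))"
  proof -
    have "real (4 * l) * (1 + Ln) \<le> (4 * a) * (1 + Ln)" using a Ln by (intro mult_right_mono) auto
    then show ?thesis by (simp add: algebra_simps)
  qed
  finally have 2: "real (n choose s) \<le> exp (4 * a + 4 * (a * Ln))" .
  have "(48::real) \<le> 2 ^ 8" by simp
  also have "\<dots> \<le> exp 1 ^ 8" using exp1 by (intro power_mono) auto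
  finally have "(48::real) ^ (2 * k + 1 + s) \<le> (exp 1 ^ 8) ^ (2 * k + 1 + s)" by (intro power_mono) auto
  also have "\<dots> = exp (real (8 * (2 * k + 1 + s)))"
    unfolding power_mult[symmetric] by (simp flip: exp_of_nat_mult del: of_nat_mult of_nat_add)
  \<comment> \<open>From s \<le> 4 l and 1 \<le> l: 16 k + 8 + 8 s \<le> 16 k + 40 l.\<close>
  also have "\<dots> \<le> exp (real (40 * (k + l)))"
    using s assms(2) unfolding exp_le_cancel_iff of_nat_le_iff by simp
  also have "\<dots> = exp (40 * a)" by (simp add: a_def)
  finally have 3: "(48::real) ^ (2 * k + 1 + s) \<le> exp (40 * a)" .
  have "2 * ((real N)\<^sup>2 * real (n choose s) * 48 ^ (2 * k + 1 + s))
      \<le> exp 1 * (exp (4 * (a * Lc)) * exp (4 * a + 4 * (a * Ln)) * exp (40 * a))"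
    using 1 2 3 exp1 by (intro mult_mono) auto
  also have "\<dots> = exp (1 + 4 * (a * Lc) + 44 * a + 4 * (a * Ln))"
    by (simp flip: exp_add)
  also have "\<dots> \<le> exp (100 * (a * Lc + a * Ln))"
  proof -
    define X Y where "X = a * Lc" and "Y = a * Ln"
    have "a * (1/2) \<le> X" unfolding X_def using a Lc by (intro mult_left_mono) auto
    moreover have "0 \<le> Y" unfolding Y_def using a Ln by simp
    \<comment> \<open>Since 1 \<le> a \<le> 2 X, the left side is at most 94 X + 4 Y.\<close>
    ultimately have "1 + 4 * X + 44 * a + 4 * Y \<le> 100 * (X + Y)" using a(3) by simp
    then have "1 + 4 * (a * Lc) + 44 * a + 4 * (a * Ln) \<le> 100 * (a * Lc + a * Ln)"
      unfolding X_def Y_def .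
    then show ?thesis by simp
  qed
  finally show ?thesis by (simp add: a_def Lc_def Ln_def mult.assoc)
qed

section \<open>Assembly of the high-probability event\<close>

lemma net_eval_eq_0: "Ls \<noteq> [] \<Longrightarrow> out_dim (last Ls) \<le> i \<Longrightarrow> net_eval Ls v i = 0"
  by (induction Ls v rule: net_eval.induct) (auto simp: affine_eq_0)

lemma relu_net_vec_in:
  assumes "relu_net k n d c0 G" shows "vec_in n (G z)"
proof -
  obtain Ls where "length Ls = d" "d \<ge> 1" "out_dim (last Ls) = n" "G = net_eval Ls"
    using assms by (auto simp: relu_net_def)
  moreover from this have "Ls \<noteq> []" by auto
  ultimately show ?thesis by (simp add: vec_in_def net_eval_eq_0)
qed

lemma gauss_mat_near_isometric_family:
  fixes n :: nat
  assumes "m > 0" "finite F" and t: "0 < t" "t \<le> 1"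
  defines "E \<equiv> {A \<in> space (gauss_mat m n). \<forall>f\<in>F. near_isometric m n A t f}"
  shows "E \<in> sets (gauss_mat m n)"
    and "measure (gauss_mat m n) E \<ge> 1 - 2 * real (card F) * exp (- (real m * t\<^sup>2 / 16))"
proof -
  interpret prob_space "gauss_mat m n" by (rule prob_space_gauss_mat) fact
  define Bd where "Bd = (\<lambda>f. {A \<in> space (gauss_mat m n). \<not> near_isometric m n A t f})"
  have Bd: "Bd f \<in> sets (gauss_mat m n)" for f
    unfolding Bd_def by (rule gauss_mat_not_near_isometric(1)[OF assms(1) t])
  have U: "(\<Union>f\<in>F. Bd f) \<in> sets (gauss_mat m n)" using Bd assms(2) by (intro sets.finite_UN) auto
  have E: "E = space (gauss_mat m n) - (\<Union>f\<in>F. Bd f)" by (auto simp: E_def Bd_def)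
  show "E \<in> sets (gauss_mat m n)" unfolding E using U by (rule sets.compl_sets)
  have "measure (gauss_mat m n) (\<Union>f\<in>F. Bd f) \<le> (\<Sum>f\<in>F. measure (gauss_mat m n) (Bd f))"
    using Bd assms(2) by (intro measure_UNION_le) auto
  also have "\<dots> \<le> (\<Sum>f\<in>F. 2 * exp (- (real m * t\<^sup>2 / 16)))"
    unfolding Bd_def by (intro sum_mono gauss_mat_not_near_isometric(2)[OF assms(1) t])
  finally have "measure (gauss_mat m n) (\<Union>f\<in>F. Bd f) \<le> 2 * real (card F) * exp (- (real m * t\<^sup>2 / 16))"
    by simp
  then show "measure (gauss_mat m n) E \<ge> 1 - 2 * real (card F) * exp (- (real m * t\<^sup>2 / 16))"
    unfolding E using prob_compl[OF U] by simp
qed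

theorem theorem2:
  shows "\<exists>C>0. \<exists>c>0. \<forall>(k::nat) (n::nat) (m::nat) (d::nat) (c0::nat) G (\<alpha>::real) (l::nat)
      (\<epsilon>max::real) (\<delta>::real).
    relu_net k n d c0 G \<and> c0 \<ge> 2 \<and> 0 < \<alpha> \<and> \<alpha> < 1 \<and> 0 < l \<and> l \<le> n \<and>
    \<epsilon>max \<ge> 0 \<and> \<delta> \<ge> 0 \<and>
    real m \<ge> C / \<alpha>^2 * (real (k + l) * real d * ln (real c0) + real (k + l) * ln (real n / real l))
    \<longrightarrow>
    (\<exists>E \<in> sets (gauss_mat m n).
       E \<subseteq> {A \<in> space (gauss_mat m n). \<exists>\<Delta> :: (nat \<Rightarrow> real) \<Rightarrow> (nat \<Rightarrow> real).
          \<forall>x \<epsilon>. vec_in n x \<and> vec_in m \<epsilon> \<and> norm2 m \<epsilon> \<le> \<epsilon>max \<longrightarrow>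
            norm2 n (\<lambda>i. x i - \<Delta> (\<lambda>j. matvec m n A x j + \<epsilon> j) i)
              \<le> (2 * real l) powr (-1/2) * (2 * ((1 + \<alpha>) / (1 - \<alpha>) + 1)) * sigma_G k n l G x
                 + 2 / (1 - \<alpha>) * \<epsilon>max + \<delta> / (1 - \<alpha>)} \<and>
       measure (gauss_mat m n) E \<ge> 1 - exp (- c * \<alpha>^2 * real m))"
proof (rule exI[of _ 80000], intro conjI, simp, rule exI[of _ "1/800"], intro conjI, simp, intro allI impI, elim conjE)
  fix k n m d c0 l :: nat and G and \<alpha> \<epsilon>max \<delta> :: real
  assume net: "relu_net k n d c0 G" and c0: "c0 \<ge> 2" and \<alpha>: "0 < \<alpha>" "\<alpha> < 1" and l: "0 < l" "l \<le> n"
    and "\<epsilon>max \<ge> 0" and \<delta>: "\<delta> \<ge> 0"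
    and m: "80000 / \<alpha>\<^sup>2 * (real (k + l) * real d * ln (real c0) + real (k + l) * ln (real n / real l)) \<le> real m"
  define Q where "Q = real (k + l) * real d * ln (real c0) + real (k + l) * ln (real n / real l)"
  define t where "t = \<alpha> / 5"
  have t: "0 < t" "t \<le> 1" "t \<ge> 0" using \<alpha> by (auto simp: t_def)
  have "d \<ge> 1" using net by (auto simp: relu_net_def)
  \<comment> \<open>Strict positivity rules out m = 0, where the variance 1 / m would be
    meaningless.\<close>
  have "Q > 0" unfolding Q_def
    using c0 l \<open>d \<ge> 1\<close> by (intro add_pos_nonneg mult_pos_pos mult_nonneg_nonneg) auto
  then have "0 < 80000 / \<alpha>\<^sup>2 * Q" using \<alpha> by simp
  then have "m > 0" using m unfolding Q_def[symmetric] by (metis linorder_not_less of_nat_0_less_iff order_less_le_trans)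
  \<comment> \<open>The logarithmic net size \<open>100 * Q\<close> uses at most half of the tail
    exponent m t^2 / 16 = m \<alpha>^2 / 400.\<close>
  have mQ: "100 * Q \<le> real m * \<alpha>\<^sup>2 / 800"
    using m \<alpha> unfolding Q_def[symmetric] by (simp add: field_simps)
  obtain P where P: "finite P" "card P \<le> (c0 + 1) ^ (k * (d - 1))"
    "\<And>z. vec_in k z \<Longrightarrow> \<exists>p\<in>P. G z = affine_map k p z"
    using relu_net_pieces[OF net] by blast
  define s where "s = min (4 * l) n"
  obtain F where F: "finite F" "real (card F) \<le> (real (card P))\<^sup>2 * real (n choose s) * 48 ^ (2 * k + 1 + s)"
    and Fiso: "\<And>m A \<tau> p q z z' w. \<tau> \<ge> 0 \<Longrightarrow> \<forall>f\<in>F. near_isometric m n A \<tau> f \<Longrightarrow> p \<in> P \<Longrightarrow> q \<in> P \<Longrightarrow>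
       card {i. i < n \<and> w i \<noteq> 0} \<le> 4 * l \<Longrightarrow>
       near_isometric m n A (5 * \<tau>) (\<lambda>i. affine_map k p z i - affine_map k q z' i + w i)"
    using pieces_net[OF P(1) s_def, of k] by blast
  define E where "E = {A \<in> space (gauss_mat m n). \<forall>f\<in>F. near_isometric m n A t f}"
  have "2 * real (card F) \<le> 2 * ((real (card P))\<^sup>2 * real (n choose s) * 48 ^ (2 * k + 1 + s))"
    using F(2) by (rule mult_left_mono) simp
  also have "\<dots> \<le> exp (100 * Q)"
    unfolding Q_def by (rule net_size_bound[OF c0 l \<open>d \<ge> 1\<close> s_def P(2)])
  also have "\<dots> \<le> exp (real m * \<alpha>\<^sup>2 / 800)" using mQ by simp
  finally have "2 * real (card F) * exp (- (real m * t\<^sup>2 / 16))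
      \<le> exp (real m * \<alpha>\<^sup>2 / 800) * exp (- (real m * t\<^sup>2 / 16))" by (rule mult_right_mono) simp
  also have "\<dots> = exp (- (1/800) * \<alpha>\<^sup>2 * real m)"
    by (simp add: t_def power_divide flip: exp_add)
  finally have small: "2 * real (card F) * exp (- (real m * t\<^sup>2 / 16)) \<le> exp (- (1/800) * \<alpha>\<^sup>2 * real m)" .
  have "measure (gauss_mat m n) E \<ge> 1 - exp (- (1/800) * \<alpha>\<^sup>2 * real m)"
    using gauss_mat_near_isometric_family(2)[OF \<open>m > 0\<close> F(1) t(1,2), of n] small
    unfolding E_def by linarith
  moreover have "E \<in> sets (gauss_mat m n)"
    unfolding E_def by (rule gauss_mat_near_isometric_family(1)[OF \<open>m > 0\<close> F(1) t(1,2)])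
  moreover have "\<exists>\<Delta> :: (nat \<Rightarrow> real) \<Rightarrow> (nat \<Rightarrow> real).
          \<forall>x \<epsilon>. vec_in n x \<and> vec_in m \<epsilon> \<and> norm2 m \<epsilon> \<le> \<epsilon>max \<longrightarrow>
            norm2 n (\<lambda>i. x i - \<Delta> (\<lambda>j. matvec m n A x j + \<epsilon> j) i)
              \<le> (2 * real l) powr (-1/2) * (2 * ((1 + \<alpha>) / (1 - \<alpha>) + 1)) * sigma_G k n l G x
                 + 2 / (1 - \<alpha>) * \<epsilon>max + \<delta> / (1 - \<alpha>)" if "A \<in> E" for A
  proof -
    have iso: "near_isometric m n A \<alpha> (\<lambda>i. G z i - G z' i + w i)"
      if z: "vec_in k z" "vec_in k z'" and w: "card {i. i < n \<and> w i \<noteq> 0} \<le> 4 * l" for z z' w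
    proof -
      obtain p where p: "p \<in> P" "G z = affine_map k p z" using P(3)[OF z(1)] by blast
      obtain q where q: "q \<in> P" "G z' = affine_map k q z'" using P(3)[OF z(2)] by blast
      have "\<forall>f\<in>F. near_isometric m n A t f" using \<open>A \<in> E\<close> by (simp add: E_def)
      then have "near_isometric m n A (5 * t) (\<lambda>i. affine_map k p z i - affine_map k q z' i + w i)"
        using Fiso[OF t(3) _ p(1) q(1) w] by blast
      then show ?thesis by (simp add: p(2) q(2) t_def)
    qed
    have "\<delta> / (1 - \<alpha>) \<ge> 0" using \<delta> \<alpha> by simp
    then have weaken: "r + \<delta> / (1 - \<alpha>) \<ge> b" if "b \<le> r" for b r using that by linarith
    have "\<exists>\<Delta> :: (nat \<Rightarrow> real) \<Rightarrow> (nat \<Rightarrow> real).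
          \<forall>x \<epsilon>. vec_in n x \<and> vec_in m \<epsilon> \<and> norm2 m \<epsilon> \<le> \<epsilon>max \<longrightarrow>
            norm2 n (\<lambda>i. x i - \<Delta> (\<lambda>j. matvec m n A x j + \<epsilon> j) i)
              \<le> (2 * real l) powr (-1/2) * (2 * ((1 + \<alpha>) / (1 - \<alpha>) + 1)) * sigma_G k n l G x
                 + 2 / (1 - \<alpha>) * \<epsilon>max"
      by (rule decoder_exists[OF iso \<alpha> l(1) relu_net_vec_in[OF net]])
    then show ?thesis
      by (rule ex_forward) (intro allI impI weaken, blast)
  qed
  ultimately show "\<exists>E \<in> sets (gauss_mat m n).
       E \<subseteq> {A \<in> space (gauss_mat m n). \<exists>\<Delta> :: (nat \<Rightarrow> real) \<Rightarrow> (nat \<Rightarrow> real).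
          \<forall>x \<epsilon>. vec_in n x \<and> vec_in m \<epsilon> \<and> norm2 m \<epsilon> \<le> \<epsilon>max \<longrightarrow>
            norm2 n (\<lambda>i. x i - \<Delta> (\<lambda>j. matvec m n A x j + \<epsilon> j) i)
              \<le> (2 * real l) powr (-1/2) * (2 * ((1 + \<alpha>) / (1 - \<alpha>) + 1)) * sigma_G k n l G x
                 + 2 / (1 - \<alpha>) * \<epsilon>max + \<delta> / (1 - \<alpha>)} \<and>
       measure (gauss_mat m n) E \<ge> 1 - exp (- (1/800) * \<alpha>^2 * real m)"
    by (intro bexI[of _ E]) (auto simp: E_def)
qed

end
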